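(* Let $\mathbb{K}$ be a field of characteristic $0$ and let $F(u)\equiv F(t,u)\in\mathbb{K}(u)[[t]]$ be a power series in $t$ whose coefficients are rational functions of $u$ without pole at $u=0$. Define $\Delta F(u)=\frac{F(u)-F(0)}{u}$ and $\Delta^{(i)}$ as the $i$-fold iterate of $\Delta$. Suppose that $$F(u)=F_0(u)+t\,\mathcal{Q}\big(F(u),\Delta F(u),\Delta^{(2)}F(u),\dots,\Delta^{(k)}F(u),t;u\big)$$ for some $k\ge0$, some $F_0(u)\in\mathbb{K}(u)$, and some $\mathcal{Q}(y_0,\dots,y_k,t;v)$ which is a polynomial in $y_0,\dots,y_k,t$ and a rational function in $v$, with coefficients in $\mathbb{K}$. Then $F(t,u)$ is algebraic over $\mathbb{K}(t,u)$.
   Context: A series is algebraic over $\mathbb{K}(t,u)$ if it satisfies a non-trivial polynomial equation with coefficients in $\mathbb{K}(t,u)$. *)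

theory Defs
  imports "HOL-Computational_Algebra.Polynomial"
          "HOL-Computational_Algebra.Fraction_Field"
          "HOL-Computational_Algebra.Formal_Power_Series"
          "HOL-Computational_Algebra.Formal_Laurent_Series"
          "HOL-Computational_Algebra.Polynomial_FPS"
begin

text \<open>K(u) is modelled as the fraction field of K[u], i.e. the type 'a poly fract.
  A series F(t,u) in K(u)[[t]] has type ('a poly fract) fps.\<close>

definition const_ratfun :: "'a::field \<Rightarrow> 'a poly fract" where
  "const_ratfun c = Fraction_Field.Fract [:c:] 1"

definition var_u :: "'a::field poly fract" where
  "var_u = Fraction_Field.Fract [:0, 1:] 1"

definition no_pole_at_0 :: "'a::field poly fract \<Rightarrow> bool" where
  "no_pole_at_0 x \<longleftrightarrow> (\<exists>p q. poly q 0 \<noteq> 0 \<and> x = Fraction_Field.Fract p q)"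

definition eval_at_0 :: "'a::field poly fract \<Rightarrow> 'a" where
  "eval_at_0 x = (THE v. \<exists>p q. poly q 0 \<noteq> 0 \<and> x = Fraction_Field.Fract p q \<and> v = poly p 0 / poly q 0)"

definition Delta :: "'a::field poly fract fps \<Rightarrow> 'a poly fract fps" where
  "Delta F = Abs_fps (\<lambda>n. (fps_nth F n - const_ratfun (eval_at_0 (fps_nth F n))) / var_u)"

text \<open>Evaluation of Q(y_0,...,y_k,t;u) = sum over monomials m in S of
  c m * y_0^(e_0) * ... * y_k^(e_k) * t^j, where m = (e, j), at y_i = Delta^i F.\<close>
definition eval_Q :: "nat \<Rightarrow> ((nat \<Rightarrow> nat) \<times> nat) set \<Rightarrow> ((nat \<Rightarrow> nat) \<times> nat \<Rightarrow> 'a::field poly fract)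
    \<Rightarrow> 'a poly fract fps \<Rightarrow> 'a poly fract fps" where
  "eval_Q k S c F = (\<Sum>m\<in>S. fps_const (c m) * (\<Prod>i\<in>{0..k}. ((Delta ^^ i) F) ^ (fst m i)) * fps_X ^ (snd m))"

text \<open>K(t,u) is modelled as the fraction field of K[u][t] ('a poly poly fract, outer variable t).
  It embeds into the field K(u)((t)) of Laurent series containing K(u)[[t]].\<close>
definition bivar_to_fls :: "'a::field poly poly \<Rightarrow> 'a poly fract fls" where
  "bivar_to_fls p = fps_to_fls (fps_of_poly (map_poly (\<lambda>c. Fraction_Field.Fract c 1) p))"

definition ratfun_tu_to_fls :: "'a::field poly poly fract \<Rightarrow> 'a poly fract fls" where
  "ratfun_tu_to_fls x = (let r = (SOME r. snd r \<noteq> 0 \<and> x = Fraction_Field.Fract (fst r) (snd r))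
                         in bivar_to_fls (fst r) / bivar_to_fls (snd r))"

definition algebraic_over_Ktu :: "'a::field poly fract fps \<Rightarrow> bool" where
  "algebraic_over_Ktu F \<longleftrightarrow>
     (\<exists>P :: 'a poly poly fract poly. P \<noteq> 0 \<and> poly (map_poly ratfun_tu_to_fls P) (fps_to_fls F) = 0)"

end

theory Submission
  imports Defs
begin

text \<open>
  An element of a field of characteristic 0 is algebraic over a subring as soon as every derivation
  vanishing on the subring kills it; so let D be a derivation of K(u)((t)) that vanishes on K[u,t].
  Apart from F the equation involves the k series G_j = [u^j] F (j < k).  If D kills all of them,
  then applying D to the equation gives D F (1 - t ...) = 0, hence D F = 0.

  To kill the G_j, expand F at u = 0 in a new variable X, so that the equation becomes a polynomial
  relation E(Y, G_0, ..., G_{k-1}, t; X) = 0 for Y = Delta^k F, after multiplication by a common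
  denominator d(X).  The series dE/dY is d X^k modulo t, so it is divisible by a distinguished
  polynomial w of degree N = k + ord d, and Y is congruent modulo w^2 to a polynomial p in X.  Thus
  w^2 divides the polynomial E(p, G, t; X).  Applying D to its coefficients shows that w divides the
  sum of the D(G_j) dE/dG_j.  Modulo t these partial derivatives are d X^j with j < k, and they
  stay linearly independent modulo X^N; therefore all D(G_j) vanish.  Squaring w is what makes
  multiple roots of the kernel dE/dY harmless, so no perturbation of the equation is needed.
\<close>

subsection \<open>Derivations detect transcendental elements\<close>

text \<open>A derivation D is encoded by its graph, a subring of the dual numbers a + D(a) eps on which
  the projection to a is injective.  Partially defined derivations are extended by Zorn's lemma.\<close>

definition derivation :: "('a::comm_ring_1 \<Rightarrow> 'a) \<Rightarrow> bool" where
  "derivation D \<longleftrightarrow> (\<forall>x y. D (x + y) = D x + D y) \<and> (\<forall>x y. D (x * y) = x * D y + y * D x)"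

definition dual_subring :: "('a::comm_ring_1 \<times> 'a) set \<Rightarrow> bool" where
  "dual_subring M \<longleftrightarrow> (1, 0) \<in> M \<and>
     (\<forall>a x b y. (a, x) \<in> M \<longrightarrow> (b, y) \<in> M \<longrightarrow> (a - b, x - y) \<in> M \<and> (a * b, a * y + b * x) \<in> M)"

text \<open>Polynomials over the ring \<open>M\<close> of dual numbers; the pair
  \<open>(p, q)\<close> stands for p + q eps.\<close>

definition dual_polys :: "('a::comm_ring_1 \<times> 'a) set \<Rightarrow> ('a poly \<times> 'a poly) set" where
  "dual_polys M = {(p, q). \<forall>i. (coeff p i, coeff q i) \<in> M}"

text \<open>Substitution of a + b eps for the variable: Taylor expansion with eps^2 = 0 produces the
  term \<open>b * poly (pderiv p) a\<close>.\<close>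

definition dual_eval :: "'a::idom \<Rightarrow> 'a \<Rightarrow> 'a poly \<times> 'a poly \<Rightarrow> 'a \<times> 'a" where
  "dual_eval a b = (\<lambda>(p, q). (poly p a, poly q a + b * poly (pderiv p) a))"

lemma dual_subringD:
  assumes "dual_subring M"
  shows "(1, 0) \<in> M"
    and "(a, x) \<in> M \<Longrightarrow> (b, y) \<in> M \<Longrightarrow> (a - b, x - y) \<in> M"
    and "(a, x) \<in> M \<Longrightarrow> (b, y) \<in> M \<Longrightarrow> (a * b, a * y + b * x) \<in> M"
  using assms unfolding dual_subring_def by blast+

lemma dual_subring_zero:
  assumes "dual_subring M"
  shows "(0, 0) \<in> M"
  using dual_subringD(2)[OF assms dual_subringD(1)[OF assms] dual_subringD(1)[OF assms]] by simp

lemma dual_subring_add: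
  assumes "dual_subring M" "(a, x) \<in> M" "(b, y) \<in> M"
  shows "(a + b, x + y) \<in> M"
  using dual_subringD(2)[OF assms(1,2) dual_subringD(2)[OF assms(1) dual_subring_zero[OF assms(1)] assms(3)]]
  by simp

lemma dual_subring_sum:
  assumes "dual_subring M" "\<And>i. i \<in> A \<Longrightarrow> (f i, g i) \<in> M"
  shows "(sum f A, sum g A) \<in> M"
  using assms(2)
proof (induction A rule: infinite_finite_induct)
  case (insert i A)
  then show ?case using dual_subring_add[OF assms(1)] by auto
qed (use dual_subring_zero[OF assms(1)] in auto)

lemma dual_subring_dual_polys:
  assumes M: "dual_subring M"
  shows "dual_subring (dual_polys M)"
  unfolding dual_subring_def
proof (intro conjI allI impI)
  show "(1, 0) \<in> dual_polys M"
    using dual_subringD(1)[OF M] dual_subring_zero[OF M] by (auto simp: dual_polys_def coeff_1)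
next
  fix p q p' q' assume *: "(p, q) \<in> dual_polys M" "(p', q') \<in> dual_polys M"
  then show "(p - p', q - q') \<in> dual_polys M"
    using dual_subringD(2)[OF M] by (auto simp: dual_polys_def)
  have "(coeff (p * p') n, coeff (p * q' + p' * q) n) \<in> M" for n
  proof -
    have "(\<Sum>i\<le>n. coeff p i * coeff p' (n - i), \<Sum>i\<le>n. coeff p i * coeff q' (n - i) + coeff p' (n - i) * coeff q i) \<in> M"
      using * by (intro dual_subring_sum[OF M] dual_subringD(3)[OF M]) (auto simp: dual_polys_def)
    moreover have "coeff (p * q' + p' * q) n = (\<Sum>i\<le>n. coeff p i * coeff q' (n - i) + coeff p' (n - i) * coeff q i)"
      unfolding mult.commute[of p' q] by (simp add: coeff_mult sum.distrib) (simp add: mult.commute)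
    ultimately show ?thesis by (simp add: coeff_mult)
  qed
  then show "(p * p', p * q' + p' * q) \<in> dual_polys M" by (auto simp: dual_polys_def)
qed

lemma dual_polys_const:
  assumes "dual_subring M" "(a, x) \<in> M"
  shows "([:a:], [:x:]) \<in> dual_polys M"
  using assms dual_subring_zero[OF assms(1)] by (auto simp: dual_polys_def coeff_pCons split: nat.split)

lemma dual_polys_monom:
  assumes "dual_subring M" "(a, x) \<in> M"
  shows "(monom a n, monom x n) \<in> dual_polys M"
  using assms dual_subring_zero[OF assms(1)] by (auto simp: dual_polys_def)

lemma dual_subring_dual_eval:
  assumes "dual_subring P"
  shows "dual_subring (dual_eval a b ` P)"
  unfolding dual_subring_def
proof (intro conjI allI impI)
  show "(1, 0) \<in> dual_eval a b ` P"
    using dual_subringD(1)[OF assms] by (force simp: dual_eval_def)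
next
  fix x y x' y' assume "(x, y) \<in> dual_eval a b ` P" "(x', y') \<in> dual_eval a b ` P"
  then obtain p q p' q' where pq: "(p, q) \<in> P" "(p', q') \<in> P"
    and eq: "(x, y) = dual_eval a b (p, q)" "(x', y') = dual_eval a b (p', q')" by auto
  have "(x - x', y - y') = dual_eval a b (p - p', q - q')"
    using eq by (simp add: dual_eval_def pderiv_diff algebra_simps)
  with dual_subringD(2)[OF assms pq] show "(x - x', y - y') \<in> dual_eval a b ` P" by blast
  have "(x * x', x * y' + x' * y) = dual_eval a b (p * p', p * q' + p' * q)"
    using eq by (simp add: dual_eval_def pderiv_mult algebra_simps)
  with dual_subringD(3)[OF assms pq] show "(x * x', x * y' + x' * y) \<in> dual_eval a b ` P" by blast
qed

text \<open>If no nonzero first component in \<open>dual_polys M\<close> vanishes at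
  \<open>a\<close>, then \<open>b\<close> can be chosen freely. Otherwise a relation
  \<open>m\<close> of least degree forces \<open>b\<close>, because m(a) = 0 must be sent to 0.
  Characteristic 0 and minimality give m'(a) nonzero, and pseudo-division by \<open>m\<close>
  reduces every other relation to one of smaller degree.\<close>

lemma exists_dual_extension:
  fixes M :: "('a::field \<times> 'a) set"
  assumes char0: "\<And>n. n > 0 \<Longrightarrow> (of_nat n :: 'a) \<noteq> 0"
    and M: "dual_subring M" and graph: "\<And>y. (0, y) \<in> M \<Longrightarrow> y = 0"
  shows "\<exists>b. \<forall>y. (0, y) \<in> dual_eval a b ` dual_polys M \<longrightarrow> y = 0"
proof -
  let ?P = "dual_polys M"
  have P: "dual_subring ?P" by (rule dual_subring_dual_polys[OF M])
  have zero: "q = 0" if "(0, q) \<in> ?P" for q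
    using that graph by (auto simp: dual_polys_def poly_eq_iff)
  define root where "root p \<longleftrightarrow> p \<noteq> 0 \<and> poly p a = 0 \<and> (\<exists>q. (p, q) \<in> ?P)" for p
  show ?thesis
  proof (cases "\<exists>p. root p")
    case False
    have "q = 0" if "(p, q) \<in> ?P" "poly p a = 0" for p q
      using that False zero unfolding root_def by metis
    moreover have "p = 0" if "(p, q) \<in> ?P" "poly p a = 0" for p q
      using that False unfolding root_def by metis
    ultimately show ?thesis
      by (intro exI[of _ 0]) (force simp: dual_eval_def)
  next
    case True
    define m where "m = arg_min degree root"
    have m: "root m" and minimal: "\<And>p. root p \<Longrightarrow> degree m \<le> degree p"
      using True arg_min_natI[of root _ degree] arg_min_nat_le[of root _ degree] by (auto simp: m_def)
    from m obtain n where n: "(m, n) \<in> ?P" and m0: "m \<noteq> 0" "poly m a = 0" by (auto simp: root_def)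
    have deg: "degree m > 0"
    proof (rule ccontr)
      assume "\<not> degree m > 0"
      then obtain c where "m = [:c:]" by (auto elim: degree_eq_zeroE)
      with m0 show False by auto
    qed
    \<comment> \<open>Integer multiples are repeated sums, so \<open>dual_polys M\<close> is closed
      under differentiating both components.\<close>
    have deriv_coeffs: "(pderiv m, pderiv n) \<in> ?P"
    proof -
      have "(of_nat i * coeff m i, of_nat i * coeff n i) \<in> M" for i
        using dual_subring_sum[OF M, of "{..<i}" "\<lambda>_. coeff m i" "\<lambda>_. coeff n i"] n
        by (auto simp: dual_polys_def)
      then show ?thesis by (auto simp: dual_polys_def coeff_pderiv simp del: of_nat_Suc)
    qed
    have coeff_d: "coeff (pderiv m) (degree m - 1) \<noteq> 0"
      using deg m0 char0[OF deg] by (simp add: coeff_pderiv del: of_nat_Suc)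
    have "degree (pderiv m) < degree m"
    proof -
      have "degree (pderiv m) \<le> degree m - 1"
        by (rule degree_le) (auto simp: coeff_pderiv coeff_eq_0)
      with deg show ?thesis by simp
    qed
    with minimal[of "pderiv m"] deriv_coeffs coeff_d have d0: "poly (pderiv m) a \<noteq> 0"
      unfolding root_def by (metis coeff_0 leD)
    \<comment> \<open>The only value for which the pair \<open>(m, n)\<close> evaluates to
      \<open>(0, 0)\<close>.\<close>
    define b where "b = - poly n a / poly (pderiv m) a"
    have mb: "poly n a + b * poly (pderiv m) a = 0" using d0 by (simp add: b_def)
    have "poly q a + b * poly (pderiv p) a = 0" if "(p, q) \<in> ?P" "poly p a = 0" for p q
      using that
    proof (induction "degree p" arbitrary: p q rule: less_induct)
      case less
      show ?case
      proof (cases "p = 0")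
        case True
        with less.prems(1) have "q = 0" using zero by simp
        with True show ?thesis by simp
      next
        case False
        with less.prems have "root p" by (auto simp: root_def)
        from minimal[OF this] have le: "degree m \<le> degree p" .
        define \<mu> \<nu> \<pi> \<rho> e where "\<mu> = lead_coeff m" and "\<nu> = coeff n (degree m)"
          and "\<pi> = lead_coeff p" and "\<rho> = coeff q (degree p)" and "e = degree p - degree m"
        have mu: "(\<mu>, \<nu>) \<in> M" and pi: "(\<pi>, \<rho>) \<in> M"
          using n less.prems(1) by (auto simp: dual_polys_def \<mu>_def \<nu>_def \<pi>_def \<rho>_def)
        \<comment> \<open>A step of pseudo-division over the dual numbers in \<open>M\<close>:
          multiplying by leading coefficients cancels the top term of \<open>p\<close> without
          inverses, which \<open>M\<close> may lack. \<open>q1\<close> is the eps-part of the same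
          expression.\<close>
        define p1 q1 where "p1 = [:\<mu>:] * p - monom \<pi> e * m"
          and "q1 = ([:\<mu>:] * q + p * [:\<nu>:]) - (monom \<pi> e * n + m * monom \<rho> e)"
        have P1: "(p1, q1) \<in> ?P" unfolding p1_def q1_def
          by (intro dual_subringD(2)[OF P] dual_subringD(3)[OF P] dual_polys_const[OF M] mu
              dual_polys_monom[OF M] pi less.prems(1) n)
        have r1: "poly p1 a = 0" using less.prems m0 by (simp add: p1_def)
        have "p1 = 0 \<or> degree p1 < degree p"
        proof -
          have "degree p1 \<le> degree p" unfolding p1_def using le
            by (intro degree_diff_le order.trans[OF degree_mult_le]) (auto simp: e_def intro!: order.trans[OF add_mono[OF degree_monom_le order.refl]])
          moreover have "coeff p1 (degree p) = 0"
            using le by (simp add: p1_def coeff_monom_mult e_def \<mu>_def \<pi>_def)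
          ultimately show ?thesis
            by (metis eq_zero_or_degree_less)
        qed
        then have "poly q1 a + b * poly (pderiv p1) a = 0"
          using less.hyps[OF _ P1 r1] zero[of q1] P1 by (cases "p1 = 0") auto
        moreover have "poly q1 a + b * poly (pderiv p1) a
            = \<mu> * (poly q a + b * poly (pderiv p) a) + poly p a * \<nu>
              - poly (monom \<pi> e) a * (poly n a + b * poly (pderiv m) a)
              - poly m a * (poly (monom \<rho> e) a + b * poly (pderiv (monom \<pi> e)) a)"
          by (simp add: p1_def q1_def pderiv_diff pderiv_mult pderiv_smult pderiv_pCons algebra_simps)
        ultimately have "\<mu> * (poly q a + b * poly (pderiv p) a) = 0"
          using less.prems m0 mb by simp
        then show ?thesis using m0 by (simp add: \<mu>_def)
      qed
    qed
    then show ?thesis by (intro exI[of _ b]) (auto simp: dual_eval_def)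
  qed
qed

text \<open>Transcendence makes differentiation of polynomials in \<open>x\<close> well defined on
  B[x]. A maximal extension of its graph, found by Zorn's lemma, is total, since otherwise
  \<open>exists_dual_extension\<close> would enlarge it.\<close>

theorem transcendental_imp_derivation:
  fixes B :: "'a::field set"
  assumes char0: "\<And>n. n > 0 \<Longrightarrow> (of_nat n :: 'a) \<noteq> 0"
    and B: "1 \<in> B" "\<And>x y. x \<in> B \<Longrightarrow> y \<in> B \<Longrightarrow> x - y \<in> B" "\<And>x y. x \<in> B \<Longrightarrow> y \<in> B \<Longrightarrow> x * y \<in> B"
    and transc: "\<And>p. (\<forall>i. coeff p i \<in> B) \<Longrightarrow> poly p x = 0 \<Longrightarrow> p = 0"
  shows "\<exists>D. derivation D \<and> (\<forall>y\<in>B. D y = 0) \<and> D x = 1"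
proof -
  \<comment> \<open>The graph of d/dx on B[x]: polynomials over \<open>B\<close> evaluated at x +
    eps.\<close>
  define G0 where "G0 = dual_eval x 1 ` dual_polys ((\<lambda>y. (y, 0)) ` B)"
  have B0: "dual_subring ((\<lambda>y. (y, 0)) ` B)" using B by (auto simp: dual_subring_def)
  have G0: "dual_subring G0" unfolding G0_def
    by (intro dual_subring_dual_eval dual_subring_dual_polys B0)
  have G0_graph: "y = 0" if "(0, y) \<in> G0" for y
  proof -
    from that obtain p q where pq: "\<forall>i. coeff p i \<in> B \<and> coeff q i = 0"
      and y: "poly p x = 0" "y = poly q x + poly (pderiv p) x"
      by (auto simp: G0_def dual_eval_def dual_polys_def image_iff)
    from pq have "q = 0" by (auto simp: poly_eq_iff)
    moreover from transc pq y have "p = 0" by blast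
    ultimately show ?thesis using y by simp
  qed
  define C where "C = {M. dual_subring M \<and> (\<forall>y. (0, y) \<in> M \<longrightarrow> y = 0) \<and> G0 \<subseteq> M}"
  have "\<exists>M\<in>C. \<forall>X\<in>C. M \<subseteq> X \<longrightarrow> X = M"
  proof (rule subset_Zorn_nonempty)
    show "C \<noteq> {}" using G0 G0_graph by (auto simp: C_def)
  next
    fix \<C> assume ne: "\<C> \<noteq> {}" and chain: "subset.chain C \<C>"
    have sub: "dual_subring M" if "M \<in> \<C>" for M
      using chain that by (auto simp: C_def subset.chain_def)
    have both: "\<exists>M\<in>\<C>. u \<in> M \<and> v \<in> M" if "u \<in> \<Union>\<C>" "v \<in> \<Union>\<C>" for u v
    proof -
      from that obtain M N where "M \<in> \<C>" "u \<in> M" "N \<in> \<C>" "v \<in> N" by auto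
      moreover then have "M \<subseteq> N \<or> N \<subseteq> M" using chain by (auto simp: subset.chain_def)
      ultimately show ?thesis by blast
    qed
    have "dual_subring (\<Union>\<C>)"
      unfolding dual_subring_def
    proof (intro conjI allI impI)
      show "(1, 0) \<in> \<Union>\<C>" using ne sub dual_subringD(1) by blast
    next
      fix a x b y assume "(a, x) \<in> \<Union>\<C>" "(b, y) \<in> \<Union>\<C>"
      from both[OF this] obtain M where M: "M \<in> \<C>" "(a, x) \<in> M" "(b, y) \<in> M" by blast
      then show "(a - b, x - y) \<in> \<Union>\<C>" "(a * b, a * y + b * x) \<in> \<Union>\<C>"
        using dual_subringD(2,3)[OF sub[OF M(1)] M(2,3)] by blast+
    qed
    then show "\<Union>\<C> \<in> C"
      using chain ne by (auto simp: C_def subset.chain_def)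
  qed
  then obtain M where M: "dual_subring M" and graph: "\<And>y. (0, y) \<in> M \<Longrightarrow> y = 0" and G0M: "G0 \<subseteq> M"
    and maximal: "\<And>X. X \<in> C \<Longrightarrow> M \<subseteq> X \<Longrightarrow> X = M" by (auto simp: C_def)
  have total: "\<exists>b. (a, b) \<in> M" for a
  proof -
    obtain b where b: "\<And>y. (0, y) \<in> dual_eval a b ` dual_polys M \<Longrightarrow> y = 0"
      using exists_dual_extension[OF char0 M graph] by blast
    let ?X = "dual_eval a b ` dual_polys M"
    have "M \<subseteq> ?X"
    proof
      fix u assume "u \<in> M"
      moreover obtain c d where u: "u = (c, d)" by (cases u)
      ultimately have "([:c:], [:d:]) \<in> dual_polys M" using dual_polys_const[OF M] by auto
      moreover have "u = dual_eval a b ([:c:], [:d:])" by (simp add: u dual_eval_def)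
      ultimately show "u \<in> ?X" by blast
    qed
    moreover from this have "?X \<in> C"
      using G0M b by (auto simp: C_def intro!: dual_subring_dual_eval dual_subring_dual_polys M)
    ultimately have "?X = M" using maximal by blast
    \<comment> \<open>The variable itself evaluates to a + b eps, so \<open>a\<close> lies in the
      domain of the maximal \<open>M\<close>.\<close>
    moreover have "dual_eval a b (monom 1 1, monom 0 1) = (a, b)"
      by (simp add: dual_eval_def poly_monom pderiv_monom)
    ultimately show ?thesis
      using dual_polys_monom[OF M dual_subringD(1)[OF M]] by (metis imageI)
  qed
  have unique: "b = b'" if "(a, b) \<in> M" "(a, b') \<in> M" for a b b'
    using graph[of "b - b'"] dual_subringD(2)[OF M that] by simp
  define D where "D a = (THE b. (a, b) \<in> M)" for a
  have D: "D a = b \<longleftrightarrow> (a, b) \<in> M" for a b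
    unfolding D_def using total unique by (metis theI')
  have DM: "(a, D a) \<in> M" for a using D by blast
  have "derivation D"
    unfolding derivation_def D using dual_subring_add[OF M] dual_subringD(3)[OF M] DM by blast
  moreover have "D y = 0" if "y \<in> B" for y
  proof -
    have "(y, 0) = dual_eval x 1 ([:y:], [:0:])" by (simp add: dual_eval_def)
    moreover have "([:y:], [:0:]) \<in> dual_polys ((\<lambda>y. (y, 0)) ` B)"
      using that by (intro dual_polys_const B0) auto
    ultimately have "(y, 0) \<in> G0" unfolding G0_def by blast
    with G0M show ?thesis unfolding D by blast
  qed
  moreover have "D x = 1"
  proof -
    have "(x, 1) = dual_eval x 1 (monom 1 1, monom 0 1)" by (simp add: dual_eval_def poly_monom pderiv_monom)
    moreover have "(monom 1 1, monom 0 1) \<in> dual_polys ((\<lambda>y. (y, 0)) ` B)"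
      using B by (intro dual_polys_monom B0) auto
    ultimately have "(x, 1) \<in> G0" unfolding G0_def by blast
    with G0M show ?thesis unfolding D by blast
  qed
  ultimately show ?thesis by blast
qed

subsection \<open>Ring homomorphisms, derivations and the polynomial Q\<close>

definition ring_map :: "('a::comm_ring_1 \<Rightarrow> 'b::comm_ring_1) \<Rightarrow> bool" where
  "ring_map h \<longleftrightarrow> (\<forall>x y. h (x + y) = h x + h y) \<and> (\<forall>x y. h (x * y) = h x * h y) \<and> h 1 = 1"

lemma ring_map_simps:
  assumes "ring_map h"
  shows "h (x + y) = h x + h y" "h (x * y) = h x * h y" "h 1 = 1" "h 0 = 0" "h (- x) = - h x"
    "h (x - y) = h x - h y" "h (x ^ n) = h x ^ n" "h (of_nat n) = of_nat n"
    "h (sum f A) = (\<Sum>i\<in>A. h (f i))" "h (prod f A) = (\<Prod>i\<in>A. h (f i))"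
proof -
  show add: "h (x + y) = h x + h y" and mult: "h (x * y) = h x * h y" and one: "h 1 = 1" for x y
    using assms by (auto simp: ring_map_def)
  show zero: "h 0 = 0" using add[of 0 0] by simp
  show uminus: "h (- x) = - h x" for x using add[of x "- x"] zero by (simp add: eq_neg_iff_add_eq_0 add.commute)
  show "h (x - y) = h x - h y" using add[of x "- y"] uminus by simp
  show "h (x ^ n) = h x ^ n" by (induction n) (auto simp: one mult)
  show "h (of_nat n) = of_nat n" by (induction n) (auto simp: one add zero)
  show "h (sum f A) = (\<Sum>i\<in>A. h (f i))" by (induction A rule: infinite_finite_induct) (auto simp: zero add)
  show "h (prod f A) = (\<Prod>i\<in>A. h (f i))" by (induction A rule: infinite_finite_induct) (auto simp: one mult)
qed

lemma ring_map_comp: "ring_map g \<Longrightarrow> ring_map h \<Longrightarrow> ring_map (g \<circ> h)"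
  by (auto simp: ring_map_def)

lemma ring_map_map_poly:
  assumes "ring_map h"
  shows "ring_map (map_poly h)"
  unfolding ring_map_def
  by (auto simp: poly_eq_iff coeff_map_poly coeff_mult ring_map_simps[OF assms])

lemma ring_map_fps_of_poly: "ring_map fps_of_poly"
  by (auto simp: ring_map_def fps_of_poly_add fps_of_poly_mult)

lemma ring_map_fps_to_fls: "ring_map fps_to_fls"
  by (auto simp: ring_map_def fls_times_fps_to_fls)

lemma ring_map_fps_nth_0: "ring_map (\<lambda>f. fps_nth f 0)"
  by (auto simp: ring_map_def)

section \<open>Coefficientwise maps and exchange of the two variables of a double power
  series\<close>

definition map_fps :: "('a \<Rightarrow> 'b) \<Rightarrow> 'a fps \<Rightarrow> 'b fps" where
  "map_fps h f = Abs_fps (\<lambda>n. h (fps_nth f n))"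

lemma map_fps_nth [simp]: "fps_nth (map_fps h f) n = h (fps_nth f n)"
  by (simp add: map_fps_def)

lemma ring_map_map_fps:
  assumes "ring_map h"
  shows "ring_map (map_fps h)"
  unfolding ring_map_def
  by (auto simp: fps_eq_iff fps_mult_nth fps_one_def ring_map_simps[OF assms])

text \<open>\<open>F\<close> is a series in t whose coefficients expand in X, whereas Weierstrass
  division produces remainders that are polynomials in X and so needs X as the outer
  variable.\<close>

definition swap_fps :: "'a fps fps \<Rightarrow> 'a fps fps" where
  "swap_fps f = Abs_fps (\<lambda>i. Abs_fps (\<lambda>j. fps_nth (fps_nth f j) i))"

lemma swap_fps_nth [simp]: "fps_nth (fps_nth (swap_fps f) i) j = fps_nth (fps_nth f j) i"
  by (simp add: swap_fps_def)

lemma swap_fps_swap_fps [simp]: "swap_fps (swap_fps f) = f"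
  by (simp add: fps_eq_iff)

lemma ring_map_swap_fps: "ring_map (swap_fps :: 'a::comm_ring_1 fps fps \<Rightarrow> _)"
  unfolding ring_map_def
proof (intro conjI allI)
  fix f g :: "'a fps fps"
  show "swap_fps (f * g) = swap_fps f * swap_fps g"
    by (auto simp: fps_eq_iff fps_mult_nth fps_sum_nth intro: sum.swap)
qed (auto simp: fps_eq_iff fps_one_def)

section \<open>Calculus of derivations\<close>

lemma derivation_simps:
  assumes "derivation D"
  shows "D (x + y) = D x + D y" "D (x * y) = x * D y + y * D x" "D 0 = 0" "D 1 = 0" "D (- x) = - D x"
    "D (x - y) = D x - D y" "D (x ^ n) = of_nat n * x ^ (n - 1) * D x"
    "D (sum f A) = (\<Sum>i\<in>A. D (f i))"
proof -
  show add: "D (x + y) = D x + D y" and mult: "D (x * y) = x * D y + y * D x" for x y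
    using assms by (auto simp: derivation_def)
  show zero: "D 0 = 0" using add[of 0 0] by simp
  show one: "D 1 = 0" using mult[of 1 1] by simp
  show uminus: "D (- x) = - D x" for x using add[of x "- x"] zero by (simp add: eq_neg_iff_add_eq_0 add.commute)
  show "D (x - y) = D x - D y" using add[of x "- y"] uminus by simp
  show "D (x ^ n) = of_nat n * x ^ (n - 1) * D x"
  proof (induction n)
    case (Suc n)
    then show ?case by (cases n) (simp_all add: mult algebra_simps)
  qed (simp add: one)
  show "D (sum f A) = (\<Sum>i\<in>A. D (f i))" by (induction A rule: infinite_finite_induct) (auto simp: zero add)
qed

lemma derivation_prod:
  assumes "derivation D" "finite A"
  shows "D (prod f A) = (\<Sum>i\<in>A. D (f i) * prod f (A - {i}))"
  using assms(2)
proof (induction A rule: finite_induct)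
  case (insert a A)
  have "(\<Sum>i\<in>A. D (f i) * prod f (insert a A - {i})) = (\<Sum>i\<in>A. f a * (D (f i) * prod f (A - {i})))"
  proof (rule sum.cong)
    fix i assume "i \<in> A"
    with insert have "insert a A - {i} = insert a (A - {i})" by auto
    with insert show "D (f i) * prod f (insert a A - {i}) = f a * (D (f i) * prod f (A - {i}))"
      by (simp add: algebra_simps)
  qed simp
  with insert show ?case
    by (simp add: derivation_simps[OF assms(1)] sum_distrib_left algebra_simps)
qed (simp add: derivation_simps[OF assms(1)])

lemma derivation_map_poly:
  assumes "derivation D"
  shows "derivation (map_poly D)"
proof -
  have "coeff (map_poly D (p * q)) n = coeff (p * map_poly D q + q * map_poly D p) n" for p q n
    unfolding mult.commute[of q "map_poly D p"]
    by (simp add: coeff_map_poly coeff_mult derivation_simps[OF assms] sum.distrib)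
      (simp add: mult.commute)
  moreover have "map_poly D (p + q) = map_poly D p + map_poly D q" for p q
    by (simp add: poly_eq_iff coeff_map_poly derivation_simps[OF assms])
  ultimately show ?thesis by (auto simp: derivation_def intro: poly_eqI)
qed

section \<open>Values and partial derivatives of Q over an arbitrary commutative ring\<close>

definition Q_val :: "nat \<Rightarrow> ((nat \<Rightarrow> nat) \<times> nat) set \<Rightarrow> ((nat \<Rightarrow> nat) \<times> nat \<Rightarrow> 'a::comm_ring_1)
    \<Rightarrow> (nat \<Rightarrow> 'a) \<Rightarrow> 'a \<Rightarrow> 'a" where
  "Q_val k S c y t = (\<Sum>m\<in>S. c m * (\<Prod>i\<in>{0..k}. y i ^ fst m i) * t ^ snd m)"

text \<open>The formal partial derivative with respect to y_i. At exponent 0 the truncated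
  \<open>fst m i - 1\<close> is harmless, as the factor \<open>of_nat (fst m i)\<close>
  vanishes.\<close>

definition Q_deriv :: "nat \<Rightarrow> ((nat \<Rightarrow> nat) \<times> nat) set \<Rightarrow> ((nat \<Rightarrow> nat) \<times> nat \<Rightarrow> 'a::comm_ring_1)
    \<Rightarrow> (nat \<Rightarrow> 'a) \<Rightarrow> 'a \<Rightarrow> nat \<Rightarrow> 'a" where
  "Q_deriv k S c y t i = (\<Sum>m\<in>S. c m * (of_nat (fst m i) * y i ^ (fst m i - 1)
      * (\<Prod>l\<in>{0..k} - {i}. y l ^ fst m l)) * t ^ snd m)"

lemma ring_map_Q_val:
  assumes "ring_map h"
  shows "h (Q_val k S c y t) = Q_val k S (h \<circ> c) (h \<circ> y) (h t)"
  by (simp add: Q_val_def ring_map_simps[OF assms])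

lemma ring_map_Q_deriv:
  assumes "ring_map h"
  shows "h (Q_deriv k S c y t i) = Q_deriv k S (h \<circ> c) (h \<circ> y) (h t) i"
  by (simp add: Q_deriv_def ring_map_simps[OF assms])

lemma Q_val_scale: "a * Q_val k S c y t = Q_val k S (\<lambda>m. a * c m) y t"
  by (simp add: Q_val_def sum_distrib_left mult.assoc)

lemma Q_val_cong:
  "(\<And>m. m \<in> S \<Longrightarrow> c m = c' m) \<Longrightarrow> (\<And>i. i \<le> k \<Longrightarrow> y i = y' i) \<Longrightarrow> Q_val k S c y t = Q_val k S c' y' t"
  by (simp add: Q_val_def)

lemma derivation_Q_val:
  assumes D: "derivation D" and c: "\<And>m. m \<in> S \<Longrightarrow> D (c m) = 0" and t: "D t = 0"
  shows "D (Q_val k S c y t) = (\<Sum>i\<in>{0..k}. Q_deriv k S c y t i * D (y i))"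
proof -
  have "D (c m * (\<Prod>i\<in>{0..k}. y i ^ fst m i) * t ^ snd m)
      = (\<Sum>i\<in>{0..k}. c m * (of_nat (fst m i) * y i ^ (fst m i - 1)
      * (\<Prod>l\<in>{0..k} - {i}. y l ^ fst m l)) * t ^ snd m * D (y i))" if "m \<in> S" for m
    using c[OF that] t
    by (simp add: derivation_simps[OF D] derivation_prod[OF D] sum_distrib_left sum_distrib_right algebra_simps)
  then show ?thesis
    by (simp add: Q_val_def Q_deriv_def derivation_simps[OF D] sum_distrib_right) (rule sum.swap)
qed

section \<open>Congruences modulo an element of a commutative ring\<close>

lemma dvd_diff_mult:
  fixes w :: "'a::comm_ring_1"
  assumes "w dvd a - a'" "w dvd b - b'"
  shows "w dvd a * b - a' * b'"
proof -
  have "a * b - a' * b' = (a - a') * b + a' * (b - b')" by (simp add: algebra_simps)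
  with assms show ?thesis by (metis dvd_add dvd_mult dvd_mult2)
qed

lemma dvd_diff_sum:
  fixes w :: "'a::comm_ring_1"
  assumes "\<And>i. i \<in> A \<Longrightarrow> w dvd f i - g i"
  shows "w dvd sum f A - sum g A"
  unfolding sum_subtractf[symmetric] by (rule dvd_sum) (use assms in auto)

lemma dvd_diff_prod:
  fixes w :: "'a::comm_ring_1"
  assumes "\<And>i. i \<in> A \<Longrightarrow> w dvd f i - g i"
  shows "w dvd prod f A - prod g A"
  using assms by (induction A rule: infinite_finite_induct) (auto intro: dvd_diff_mult)

lemma dvd_diff_power:
  fixes w :: "'a::comm_ring_1"
  assumes "w dvd a - b"
  shows "w dvd a ^ n - b ^ n"
  by (induction n) (auto intro: dvd_diff_mult assms)

lemma dvd_Q_val_diff: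
  assumes "\<And>i. i \<le> k \<Longrightarrow> w dvd y i - y' i"
  shows "w dvd Q_val k S c y t - Q_val k S c y' t"
  unfolding Q_val_def using assms
  by (intro dvd_diff_sum dvd_diff_mult dvd_diff_prod dvd_diff_power) auto

lemma dvd_Q_deriv_diff:
  assumes "\<And>i. i \<le> k \<Longrightarrow> w dvd y i - y' i" "i \<le> k"
  shows "w dvd Q_deriv k S c y t i - Q_deriv k S c y' t i"
  unfolding Q_deriv_def using assms
  by (intro dvd_diff_sum dvd_diff_mult dvd_diff_prod dvd_diff_power) auto

subsection \<open>Weierstrass division\<close>

text \<open>Sets the inner variable to 0; with t inside and X outside this is reduction modulo
  t.\<close>

abbreviation red :: "'a::zero fps fps \<Rightarrow> 'a fps" where
  "red \<equiv> map_fps (\<lambda>f. fps_nth f 0)"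

abbreviation red_poly :: "'a::zero fps poly \<Rightarrow> 'a poly" where
  "red_poly \<equiv> map_poly (\<lambda>f. fps_nth f 0)"

lemma ring_map_red: "ring_map (red :: 'a::comm_ring_1 fps fps \<Rightarrow> _)"
  by (intro ring_map_map_fps ring_map_fps_nth_0)

lemma ring_map_red_poly: "ring_map (red_poly :: 'a::comm_ring_1 fps poly \<Rightarrow> _)"
  by (intro ring_map_map_poly ring_map_fps_nth_0)

lemma fps_of_poly_map_poly: "h 0 = 0 \<Longrightarrow> fps_of_poly (map_poly h p) = map_fps h (fps_of_poly p)"
  by (simp add: fps_eq_iff coeff_map_poly)

lemma red_fps_X [simp]: "red (fps_X :: 'a::comm_ring_1 fps fps) = fps_X"
  by (auto simp: fps_eq_iff fps_X_def)

text \<open>The coefficient of t^n in the quotient, with \<open>h\<close> and \<open>g\<close> read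
  as series in t over series in X: after subtracting what the lower coefficients contribute, the
  part divisible by X^N is divided by the leading term X^N v of \<open>h\<close>.\<close>

fun weierstrass_quot :: "nat \<Rightarrow> 'a::field fps \<Rightarrow> 'a fps fps \<Rightarrow> 'a fps fps \<Rightarrow> nat \<Rightarrow> 'a fps" where
  "weierstrass_quot N v h g n = fps_shift N
     (fps_nth g n - (\<Sum>i\<in>{..<n}. weierstrass_quot N v h g i * fps_nth h (n - i))) * inverse v"

declare weierstrass_quot.simps [simp del]

text \<open>The quotient is built by recursion on the power of the inner variable, for which the
  series have to be read with the roles of the two variables exchanged.\<close>

lemma weierstrass_division:
  fixes h g :: "'a::field fps fps"
  assumes h: "red h = fps_X ^ N * v" and v: "fps_nth v 0 \<noteq> 0"
  obtains q r where "g = q * h + fps_of_poly r" "\<And>i. i \<ge> N \<Longrightarrow> coeff r i = 0"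
proof -
  define h' g' where "h' = swap_fps h" and "g' = swap_fps g"
  have h0: "fps_nth h' 0 = fps_X ^ N * v" using h by (simp add: fps_eq_iff h'_def)
  define q' where "q' = Abs_fps (weierstrass_quot N v h' g')"
  define r' where "r' = g' - q' * h'"
  have cutoff: "u - fps_shift N u * fps_X ^ N = fps_cutoff N u" for u :: "'a fps"
    using fps_shift_cutoff[of N u] by (simp add: diff_eq_eq add.commute)
  have r': "fps_nth r' n = fps_cutoff N (fps_nth g' n - (\<Sum>i\<in>{..<n}. fps_nth q' i * fps_nth h' (n - i)))"
    (is "_ = fps_cutoff N ?f") for n
  proof -
    have "fps_nth (q' * h') n = (\<Sum>i\<in>{..<n}. fps_nth q' i * fps_nth h' (n - i)) + fps_nth q' n * fps_nth h' 0"
      by (simp add: fps_mult_nth atLeast0AtMost lessThan_Suc_atMost[symmetric])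
    moreover have "fps_nth q' n * fps_nth h' 0 = fps_shift N ?f * fps_X ^ N"
    proof -
      have "fps_nth q' n = fps_shift N ?f * inverse v"
        unfolding q'_def fps_nth_Abs_fps by (rule weierstrass_quot.simps)
      moreover have "inverse v * v = 1" using v by (rule inverse_mult_eq_1)
      ultimately show ?thesis by (simp add: h0 algebra_simps)
    qed
    ultimately have "fps_nth r' n = ?f - fps_shift N ?f * fps_X ^ N" by (simp add: r'_def)
    also have "\<dots> = fps_cutoff N ?f"
      by (rule cutoff)
    finally show ?thesis .
  qed
  \<comment> \<open>Every t-coefficient of \<open>r'\<close> has X-degree below \<open>N\<close>, so
    after the exchange of variables the remainder is a polynomial in X and the truncation loses
    nothing.\<close>
  define r where "r = truncate_fps N (swap_fps r')"
  have "fps_nth (fps_nth (swap_fps r') i) n = 0" if "i \<ge> N" for i n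
    using that by (simp add: r')
  then have r: "fps_of_poly r = swap_fps r'"
    by (auto simp: r_def fps_eq_iff not_less coeff_truncate_fps)
  have "g' = q' * h' + r'" by (simp add: r'_def)
  then have "swap_fps g' = swap_fps q' * swap_fps h' + fps_of_poly r"
    using r by (simp add: ring_map_simps[OF ring_map_swap_fps])
  then show thesis using that[of "swap_fps q'" r] by (simp add: g'_def h'_def r_def)
qed

text \<open>The exponent is the least t-order among the coefficients of \<open>f\<close>.\<close>

lemma fps_fps_factor_inner:
  fixes f :: "'a::field fps fps"
  assumes "f \<noteq> 0"
  obtains n g where "f = fps_const (fps_X ^ n) * g" "red g \<noteq> 0"
proof -
  define P where "P n \<longleftrightarrow> (\<exists>i. fps_nth (fps_nth f i) n \<noteq> 0)" for n
  have "\<exists>n. P n" using assms by (auto simp: P_def fps_eq_iff)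
  define n where "n = (LEAST n. P n)"
  have n: "P n" and below: "\<And>m. m < n \<Longrightarrow> \<not> P m"
    unfolding n_def using \<open>\<exists>n. P n\<close> LeastI_ex not_less_Least by blast+
  define g where "g = map_fps (fps_shift n) f"
  have "f = fps_const (fps_X ^ n) * g"
    using below by (auto simp: fps_eq_iff g_def fps_X_power_mult_nth P_def)
  moreover have "red g \<noteq> 0" using n by (auto simp: fps_eq_iff g_def P_def)
  ultimately show thesis by (rule that)
qed

text \<open>For a monic divisor the scaling factor of pseudo-division is a power of 1.\<close>

lemma monic_division:
  fixes w f :: "'a::idom poly"
  assumes "lead_coeff w = 1"
  obtains s r where "f = w * s + r" "r = 0 \<or> degree r < degree w"
proof -
  obtain s r where sr: "pseudo_divmod f w = (s, r)" by (cases "pseudo_divmod f w")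
  have "w \<noteq> 0" using assms by auto
  from pseudo_divmod[OF this sr] assms that show thesis by simp
qed

text \<open>This is the uniqueness of Weierstrass division. A nonzero remainder \<open>r\<close>
  would be \<open>w\<close> times a series; once the power of t is factored out, that product is
  X^(degree w) times a nonzero series modulo t, so \<open>r\<close> would have a nonzero coefficient
  at or above \<open>degree w\<close>.\<close>

lemma fps_of_poly_dvd_imp_dvd:
  fixes w f :: "'a::field fps poly"
  assumes monic: "lead_coeff w = 1" and red_w: "red_poly w = monom 1 (degree w)"
    and dvd: "fps_of_poly w dvd fps_of_poly f"
  shows "w dvd f"
proof -
  obtain s r where f: "f = w * s + r" and r: "r = 0 \<or> degree r < degree w"
    using monic_division[OF monic] by blast
  from dvd obtain q where "fps_of_poly f = fps_of_poly w * q" by (auto elim: dvdE)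
  then have eq: "fps_of_poly r = fps_of_poly w * (q - fps_of_poly s)" (is "_ = _ * ?h")
    using f by (simp add: fps_of_poly_add fps_of_poly_mult algebra_simps)
  have "r = 0"
  proof (rule ccontr)
    assume "r \<noteq> 0"
    then have "?h \<noteq> 0" using eq by (metis fps_of_poly_0 fps_of_poly_eq_iff mult_zero_right)
    then obtain n g where g: "?h = fps_const (fps_X ^ n) * g" "red g \<noteq> 0"
      by (rule fps_fps_factor_inner)
    let ?d = "degree w"
    have "red (fps_of_poly w * g) = fps_X ^ ?d * red g"
      using red_w by (simp add: ring_map_simps[OF ring_map_red] fps_of_poly_map_poly[symmetric] fps_of_poly_monom')
    moreover obtain i where i: "fps_nth (red g) i \<noteq> 0" using g(2) by (auto simp: fps_eq_iff)
    ultimately have "fps_nth (fps_nth (fps_of_poly w * g) (?d + i)) 0 \<noteq> 0"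
      by (simp add: fps_eq_iff fps_X_power_mult_nth del: map_fps_nth) (metis map_fps_nth add_diff_cancel_left' not_add_less1)
    moreover have "fps_nth (fps_of_poly r) (?d + i) = fps_X ^ n * fps_nth (fps_of_poly w * g) (?d + i)"
      unfolding eq g(1) by (simp add: mult.left_commute[of "fps_of_poly w"])
    ultimately have "coeff r (?d + i) \<noteq> 0" by (auto simp: fps_of_poly_nth)
    then have "?d + i \<le> degree r" by (rule le_degree)
    with r \<open>r \<noteq> 0\<close> show False by auto
  qed
  with f show ?thesis by simp
qed

text \<open>Division of X^N by \<open>h\<close> leaves a remainder \<open>r\<close> of degree below
  \<open>N\<close>. Modulo t everything else is divisible by X^N, so \<open>r\<close> vanishes there
  and the quotient is a unit; hence X^N - r is the distinguished polynomial.\<close>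

lemma weierstrass_preparation:
  fixes h :: "'a::field fps fps"
  assumes h: "red h = fps_X ^ N * v" and v: "fps_nth v 0 \<noteq> 0"
  obtains w where "lead_coeff w = 1" "degree w = N" "red_poly w = monom 1 N" "fps_of_poly w dvd h"
proof -
  obtain q r where qr: "fps_X ^ N = q * h + fps_of_poly r" and r: "\<And>i. i \<ge> N \<Longrightarrow> coeff r i = 0"
    using weierstrass_division[OF h v] by blast
  have "fps_X ^ N = red (fps_X ^ N :: 'a fps fps)"
    by (simp add: ring_map_simps[OF ring_map_red])
  also have "\<dots> = red q * (fps_X ^ N * v) + red (fps_of_poly r)"
    unfolding qr by (simp add: ring_map_simps[OF ring_map_red] h)
  finally have red_eq: "fps_X ^ N = fps_X ^ N * (red q * v) + red (fps_of_poly r)" by (simp add: algebra_simps)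
  have red_r: "red (fps_of_poly r) = 0"
  proof (rule fps_ext)
    fix i
    show "fps_nth (red (fps_of_poly r)) i = fps_nth 0 i"
    proof (cases "i < N")
      case True
      with arg_cong[OF red_eq, of "\<lambda>f. fps_nth f i"] show ?thesis
        by (simp add: fps_X_power_mult_nth fps_X_power_nth)
    qed (simp add: r)
  qed
  with red_eq have "red q * v = 1" by simp
  then have "fps_nth (red q) 0 \<noteq> 0" using v by (metis fps_mult_nth_0 fps_one_nth mult_zero_left zero_neq_one)
  then have q0: "fps_nth q 0 * inverse (fps_nth q 0) = 1" by (simp add: inverse_mult_eq_1')
  then obtain q' where q': "q * q' = 1" using fps_right_inverse by blast
  define w where "w = monom 1 N - r"
  have coeff_w: "coeff w N = 1" "\<And>i. i > N \<Longrightarrow> coeff w i = 0" by (auto simp: w_def r)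
  then have deg: "degree w = N"
    by (metis degree_le le_antisym le_degree zero_neq_one)
  have "fps_of_poly w = h * q"
    using qr by (simp add: w_def fps_of_poly_diff fps_of_poly_monom' algebra_simps)
  then have "h = fps_of_poly w * q'" using q' by (simp add: mult.assoc)
  moreover have "red_poly w = monom 1 N"
  proof -
    have "fps_nth (coeff r i) 0 = 0" for i
      using arg_cong[OF red_r, of "\<lambda>f. fps_nth f i"] by simp
    then show ?thesis by (auto simp: w_def poly_eq_iff coeff_map_poly)
  qed
  ultimately show thesis using that coeff_w deg by auto
qed

text \<open>Dividing by \<open>w\<close>, and then dividing the quotient by \<open>w\<close> again,
  leaves the polynomial \<open>r2 * w + r1\<close>.\<close>

lemma poly_approx_mod_power2:
  fixes w :: "'a::field fps poly" and g :: "'a fps fps"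
  assumes "red_poly w = monom 1 N"
  obtains p where "fps_of_poly (w ^ 2) dvd g - fps_of_poly p"
proof -
  have red: "red (fps_of_poly w) = fps_X ^ N * 1"
    using assms by (simp add: fps_of_poly_map_poly[symmetric] fps_of_poly_monom')
  have one: "fps_nth (1 :: 'a fps) 0 \<noteq> 0" by simp
  obtain q1 r1 where 1: "g = q1 * fps_of_poly w + fps_of_poly r1"
    using weierstrass_division[OF red one, of g] by blast
  obtain q2 r2 where 2: "q1 = q2 * fps_of_poly w + fps_of_poly r2"
    using weierstrass_division[OF red one, of q1] by blast
  have "g - fps_of_poly (r2 * w + r1) = fps_of_poly (w ^ 2) * q2"
    unfolding 1 2 by (simp add: fps_of_poly_add fps_of_poly_mult fps_of_poly_power power2_eq_square algebra_simps)
  then show thesis using that by (metis dvd_triv_left)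
qed

text \<open>Scaling by a power of t makes all \<open>x j\<close> power series, one of them with
  nonzero constant term. Modulo t, X^(k + order 0 d) then divides \<open>d\<close> times a nonzero
  polynomial of degree below \<open>k\<close>, which is impossible.\<close>

lemma independent_mod_distinguished:
  fixes w :: "'a::field fps poly" and e :: "nat \<Rightarrow> 'a fps poly" and x :: "nat \<Rightarrow> 'a fls"
  assumes monic: "lead_coeff w = 1" and red_w: "red_poly w = monom 1 (degree w)"
    and deg: "degree w = k + order 0 d" and d: "d \<noteq> 0"
    and red_e: "\<And>j. j < k \<Longrightarrow> red_poly (e j) = d * monom 1 j"
    and dvd: "map_poly fps_to_fls w dvd (\<Sum>j<k. [:x j:] * map_poly fps_to_fls (e j))"
    and j: "j < k"
  shows "x j = 0"
proof (rule ccontr)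
  assume "x j \<noteq> 0"
  let ?\<iota> = "map_poly fps_to_fls :: 'a fps poly \<Rightarrow> 'a fls poly"
  have \<iota>: "ring_map ?\<iota>" by (intro ring_map_map_poly ring_map_fps_to_fls)
  define J where "J = {j. j < k \<and> x j \<noteq> 0}"
  define n where "n = Min ((\<lambda>j. fls_subdegree (x j)) ` J)"
  have J: "finite J" "J \<noteq> {}" using j \<open>x j \<noteq> 0\<close> by (auto simp: J_def)
  then have "n \<in> (\<lambda>j. fls_subdegree (x j)) ` J" unfolding n_def by (intro Min_in) auto
  then obtain j0 where j0: "j0 \<in> J" "n = fls_subdegree (x j0)" by auto
  \<comment> \<open>Here \<open>n\<close> is the least order in t of a nonzero \<open>x j\<close>,
    attained at \<open>j0\<close>; shifting by \<open>n\<close> is multiplication by t^(-n).\<close>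
  define c where "c j = fls_regpart (fls_shift n (x j))" for j
  have c: "fps_to_fls (c j) = fls_shift n 1 * x j" if "j < k" for j
  proof -
    have "0 \<le> fls_subdegree (fls_shift n (x j))"
    proof (cases "x j = 0")
      case False
      with that J have "n \<le> fls_subdegree (x j)" by (auto simp: n_def J_def)
      with False show ?thesis by simp
    qed auto
    then have "fps_to_fls (c j) = fls_shift n (x j)" unfolding c_def by simp
    also have "\<dots> = fls_shift n 1 * x j" by (simp add: fls_shifted_times_simps)
    finally show ?thesis .
  qed
  define f where "f = (\<Sum>j<k. [:c j:] * e j)"
  have \<iota>f_eq: "?\<iota> f = [:fls_shift n 1:] * (\<Sum>j<k. [:x j:] * ?\<iota> (e j))"
    unfolding f_def ring_map_simps[OF \<iota>] sum_distrib_left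
    by (intro sum.cong) (simp_all add: c map_poly_pCons mult.commute)
  have \<iota>f: "?\<iota> w dvd ?\<iota> f" unfolding \<iota>f_eq by (rule dvd_mult[OF dvd])
  \<comment> \<open>Division by the monic \<open>w\<close> stays over power series, and the
    embedding into Laurent series keeps degrees, so divisibility there already forces
    \<open>r = 0\<close>.\<close>
  obtain s r where f: "f = w * s + r" and r: "r = 0 \<or> degree r < degree w"
    using monic_division[OF monic] by blast
  have "?\<iota> r = ?\<iota> f - ?\<iota> w * ?\<iota> s" unfolding f by (simp add: ring_map_simps[OF \<iota>])
  with \<iota>f have "?\<iota> w dvd ?\<iota> r" by simp
  moreover have degree: "degree (?\<iota> p) = degree p" for p by (rule degree_map_poly) auto
  ultimately have "r = 0" using r
    by (metis dvd_imp_degree_le leD map_poly_eq_0_iff fps_zero_to_fls fps_to_fls_eq_0_iff degree)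
  with f have "f = w * s" by simp
  from arg_cong[OF this, of red_poly]
  have eq: "red_poly f = monom 1 (degree w) * red_poly s"
    by (simp add: ring_map_simps[OF ring_map_red_poly] red_w)
  define h where "h = (\<Sum>j<k. monom (fps_nth (c j) 0) j)"
  have "red_poly f = d * h"
    unfolding f_def h_def ring_map_simps[OF ring_map_red_poly] sum_distrib_left
    by (intro sum.cong) (simp_all add: red_e map_poly_pCons smult_monom mult.left_commute)
  with eq have "monom 1 (degree w) dvd d * h" by simp
  moreover have coeff_h: "coeff h i = (if i < k then fps_nth (c i) 0 else 0)" for i
    by (auto simp: h_def coeff_sum)
  then have "coeff h j0 \<noteq> 0" using j0 by (auto simp: J_def c_def)
  then have "h \<noteq> 0" by auto
  ultimately have "order 0 h \<ge> k" using d deg by (simp add: monom_1_dvd_iff order_mult)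
  then have "monom 1 k dvd h" using \<open>h \<noteq> 0\<close> by (simp add: monom_1_dvd_iff)
  then have "k \<le> degree h" using \<open>h \<noteq> 0\<close> by (metis dvd_imp_degree_le degree_monom_eq one_neq_zero)
  with \<open>h \<noteq> 0\<close> have "coeff h (degree h) = 0" by (simp add: coeff_h)
  with \<open>h \<noteq> 0\<close> show False by simp
qed

subsection \<open>The coefficients of small powers of the catalytic variable\<close>

text \<open>The outer variable of \<open>\<Phi>\<close> is X and the inner one, written
  \<open>fps_const fps_X\<close>, is t. The shifts of \<open>\<Phi>\<close> in X play the role of
  the iterates of \<open>Delta\<close>, and \<open>d\<close> that of the common denominator. The
  field \<open>'a\<close> will be K(u), with X independent of u.\<close>

theorem derivation_kills_boundary_coeffs:
  fixes \<Phi> :: "'a::field fps fps" and d f0 :: "'a poly" and c :: "(nat \<Rightarrow> nat) \<times> nat \<Rightarrow> 'a poly"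
    and D :: "'a fls \<Rightarrow> 'a fls"
  defines "lift \<equiv> map_poly fps_const :: 'a poly \<Rightarrow> 'a fps poly"
  assumes d: "d \<noteq> 0"
    and eq: "fps_of_poly (lift d) * \<Phi> = fps_of_poly (lift f0)
      + fps_const fps_X * Q_val k S (\<lambda>m. fps_of_poly (lift (c m))) (\<lambda>i. fps_shift i \<Phi>) (fps_const fps_X)"
    and D: "derivation D" and D_const: "\<And>a. D (fls_const a) = 0" and D_X: "D fls_X = 0"
    and j: "j < k"
  shows "D (fps_to_fls (fps_nth \<Phi> j)) = 0"
proof -
  define t where "t = [:fps_X :: 'a fps:]"
  have t: "fps_of_poly t = fps_const fps_X" by (simp add: t_def fps_of_poly_const)
  note T = ring_map_simps[OF ring_map_fps_of_poly]
  define Y where "Y = fps_shift k \<Phi>"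
  \<comment> \<open>The unknowns of E: the boundary series G_l for \<open>l < k\<close>, and Y at
    index \<open>k\<close>. Each shift of \<open>\<Phi>\<close> is a combination of them with powers
    of X as coefficients.\<close>
  define z where "z l = (if l < k then fps_const (fps_nth \<Phi> l) else Y)" for l
  define y where "y i = fps_shift i \<Phi>" for i
  have y: "y i = (\<Sum>l\<in>{i..k}. z l * fps_X ^ (l - i))" if "i \<le> k" for i
  proof -
    have "{i..k} = insert k {i..<k}" using that by auto
    then have *: "(\<Sum>l\<in>{i..k}. z l * fps_X ^ (l - i)) = Y * fps_X ^ (k - i)
        + (\<Sum>l\<in>{i..<k}. fps_const (fps_nth \<Phi> l) * fps_X ^ (l - i))"
      by (simp add: z_def)
    show ?thesis
    proof (rule fps_ext)
      fix n
      have "fps_nth (\<Sum>l\<in>{i..<k}. fps_const (fps_nth \<Phi> l) * fps_X ^ (l - i)) n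
          = (\<Sum>l\<in>{i..<k}. if l = n + i then fps_nth \<Phi> l else 0)"
        unfolding fps_sum_nth by (intro sum.cong) (auto simp: fps_X_power_nth)
      also have "\<dots> = (if n + i < k then fps_nth \<Phi> (n + i) else 0)" by simp
      finally show "fps_nth (y i) n = fps_nth (\<Sum>l\<in>{i..k}. z l * fps_X ^ (l - i)) n"
        unfolding * using that by (auto simp: y_def Y_def fps_X_power_mult_right_nth)
    qed
  qed
  \<comment> \<open>The series dE/dY, by the chain rule: Y enters \<open>y i\<close> with
    coefficient X^(k - i).\<close>
  define \<kappa> where "\<kappa> = fps_of_poly (lift d) * fps_X ^ k - fps_const fps_X
      * (\<Sum>i\<in>{0..k}. Q_deriv k S (\<lambda>m. fps_of_poly (lift (c m))) y (fps_const fps_X) i * fps_X ^ (k - i))"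
  have red_lift: "red_poly (lift p) = p" for p
    by (simp add: poly_eq_iff coeff_map_poly lift_def)
  have red_t: "red (fps_const fps_X) = (0 :: 'a fps)" by (simp add: fps_eq_iff)
  have red_\<kappa>: "red \<kappa> = fps_of_poly d * fps_X ^ k"
    unfolding \<kappa>_def ring_map_simps[OF ring_map_red] red_t
    by (simp add: fps_of_poly_map_poly[symmetric] red_lift)
  \<comment> \<open>Splitting off the power of X in \<open>d\<close> exhibits
    \<open>\<kappa>\<close> modulo t as X^N times a unit.\<close>
  obtain d' where d': "d = [:-0, 1:] ^ order 0 d * d'" "\<not> [:-0, 1:] dvd d'"
    using order_decomp[OF d, of 0] by blast
  define N where "N = k + order 0 d"
  have "red \<kappa> = fps_X ^ N * fps_of_poly d'"
    unfolding red_\<kappa> N_def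
    by (subst d'(1)) (simp add: fps_of_poly_mult fps_of_poly_power power_add algebra_simps)
  moreover have "fps_nth (fps_of_poly d') 0 \<noteq> 0"
    using d'(2) poly_eq_0_iff_dvd[of d' 0] by (simp add: poly_0_coeff_0)
  ultimately obtain w where w: "lead_coeff w = 1" "degree w = N" "red_poly w = monom 1 N" "fps_of_poly w dvd \<kappa>"
    by (rule weierstrass_preparation)
  obtain p where p: "fps_of_poly (w ^ 2) dvd Y - fps_of_poly p"
    using poly_approx_mod_power2[OF w(3)] by blast
  \<comment> \<open>Polynomial stand-ins modulo \<open>w ^ 2\<close>: only Y is replaced, by
    \<open>p\<close>.\<close>
  define z' where "z' l = (if l < k then [:fps_nth \<Phi> l:] else p)" for l
  define y' where "y' i = (\<Sum>l\<in>{i..k}. z' l * monom 1 (l - i))" for i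
  have z_cong: "fps_of_poly (w ^ 2) dvd fps_of_poly (z' l) - z l" for l
    using p dvd_minus_iff[of "fps_of_poly (w ^ 2)" "Y - fps_of_poly p"]
    by (auto simp: z_def z'_def fps_of_poly_const)
  have y_cong: "fps_of_poly (w ^ 2) dvd (fps_of_poly \<circ> y') i - y i" if "i \<le> k" for i
    unfolding y[OF that] y'_def o_def T fps_of_poly_monom'
    by (intro dvd_diff_sum dvd_diff_mult z_cong[unfolded T]) auto
  define Ep where "Ep = lift d * y' 0 - lift f0 - t * Q_val k S (lift \<circ> c) y' t"
  define dQ where "dQ = Q_deriv k S (lift \<circ> c) y' t"
  have comp: "fps_of_poly \<circ> (lift \<circ> c) = (\<lambda>m. fps_of_poly (lift (c m)))" by (simp add: fun_eq_iff)
  have "fps_of_poly (w ^ 2) dvd fps_of_poly Ep - (fps_of_poly (lift d) * y 0 - fps_of_poly (lift f0)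
      - fps_const fps_X * Q_val k S (\<lambda>m. fps_of_poly (lift (c m))) y (fps_const fps_X))"
  proof -
    let ?Q = "\<lambda>y. Q_val k S (\<lambda>m. fps_of_poly (lift (c m))) y (fps_const fps_X)"
    have "fps_of_poly Ep = fps_of_poly (lift d) * (fps_of_poly \<circ> y') 0 - fps_of_poly (lift f0)
      - fps_const fps_X * ?Q (fps_of_poly \<circ> y')"
      unfolding Ep_def T ring_map_Q_val[OF ring_map_fps_of_poly] t comp by simp
    then have "fps_of_poly Ep - (fps_of_poly (lift d) * y 0 - fps_of_poly (lift f0) - fps_const fps_X * ?Q y)
      = fps_of_poly (lift d) * ((fps_of_poly \<circ> y') 0 - y 0) - fps_const fps_X * (?Q (fps_of_poly \<circ> y') - ?Q y)"
      by (simp only: right_diff_distrib) simp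
    also have "fps_of_poly (w ^ 2) dvd \<dots>"
      by (intro dvd_diff dvd_mult dvd_Q_val_diff y_cong) auto
    finally show ?thesis .
  qed
  also have "fps_of_poly (lift d) * y 0 - fps_of_poly (lift f0)
      - fps_const fps_X * Q_val k S (\<lambda>m. fps_of_poly (lift (c m))) y (fps_const fps_X) = 0"
    using eq unfolding y_def by simp
  finally have "fps_of_poly (w ^ 2) dvd fps_of_poly Ep" by simp
  moreover have "w \<noteq> 0" using w(1) by auto
  moreover have "lead_coeff (w ^ 2) = 1" by (simp only: lead_coeff_power w(1) power_one)
  \<comment> \<open>The square \<open>w ^ 2\<close> is again monic and equals a power of X modulo t,
    so divisibility descends from series to polynomials.\<close>
  ultimately have w2: "w ^ 2 dvd Ep"
    using w(2,3) by (intro fps_of_poly_dvd_imp_dvd)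
      (simp_all add: degree_power_eq ring_map_simps[OF ring_map_red_poly] monom_power mult.commute)
  \<comment> \<open>The partial derivative of E with respect to the unknown of index
    \<open>l\<close>, taken at the stand-ins. Only \<open>i \<le> l\<close> contributes, because
    that unknown does not occur in the later \<open>y i\<close>.\<close>
  define e where "e l = lift d * monom 1 l - t * (\<Sum>i\<in>{0..l}. dQ i * monom 1 (l - i))" for l
  have "fps_of_poly (w ^ 2) dvd \<kappa> - fps_of_poly (e k)"
  proof -
    have "\<kappa> - fps_of_poly (e k) = fps_const fps_X *
       ((\<Sum>i\<in>{0..k}. fps_of_poly (dQ i) * fps_X ^ (k - i))
       - (\<Sum>i\<in>{0..k}. Q_deriv k S (\<lambda>m. fps_of_poly (lift (c m))) y (fps_const fps_X) i * fps_X ^ (k - i)))"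
      unfolding e_def T t \<kappa>_def fps_of_poly_monom' by (simp add: algebra_simps)
    also have "fps_of_poly (w ^ 2) dvd \<dots>"
      unfolding dQ_def ring_map_Q_deriv[OF ring_map_fps_of_poly] t comp
      by (intro dvd_mult dvd_diff_sum dvd_diff_mult dvd_Q_deriv_diff y_cong) auto
    finally show ?thesis .
  qed
  then have "fps_of_poly w dvd \<kappa> - fps_of_poly (e k)"
    unfolding T power2_eq_square by (rule dvd_mult_left)
  then have "fps_of_poly w dvd fps_of_poly (e k)"
    using dvd_diff[OF w(4), of "\<kappa> - fps_of_poly (e k)"] by simp
  then have w_ek: "w dvd e k" using w by (intro fps_of_poly_dvd_imp_dvd) auto
  have red_e: "red_poly (e l) = d * monom 1 l" for l
    unfolding e_def ring_map_simps[OF ring_map_red_poly] t_def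
    by (simp add: red_lift map_poly_pCons map_poly_monom)
  let ?\<iota> = "map_poly fps_to_fls :: 'a fps poly \<Rightarrow> 'a fls poly"
  have \<iota>: "ring_map ?\<iota>" by (intro ring_map_map_poly ring_map_fps_to_fls)
  note \<iota>s = ring_map_simps[OF \<iota>]
  \<comment> \<open>\<open>D\<close> acts on Laurent series in t; its coefficientwise extension
    treats X as a constant.\<close>
  define D' where "D' = map_poly D"
  have D': "derivation D'" unfolding D'_def by (rule derivation_map_poly[OF D])
  note D's = derivation_simps[OF D']
  have D'_lift: "D' (?\<iota> (lift q)) = 0" for q
    by (simp add: D'_def lift_def poly_eq_iff coeff_map_poly derivation_simps[OF D] D_const)
  have D'_t: "D' (?\<iota> t) = 0" by (simp add: D'_def t_def map_poly_pCons derivation_simps[OF D] D_X)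
  have D'_monom: "D' (?\<iota> (monom 1 n)) = 0" for n
    by (simp add: D'_def map_poly_monom derivation_simps[OF D])
  have D'_y: "D' (?\<iota> (y' i)) = (\<Sum>l\<in>{i..k}. D' (?\<iota> (z' l)) * ?\<iota> (monom 1 (l - i)))" for i
    unfolding y'_def \<iota>s D's D'_monom by (simp add: mult.commute)
  have "D' (?\<iota> Ep) = ?\<iota> (lift d) * D' (?\<iota> (y' 0)) - ?\<iota> t * D' (Q_val k S (?\<iota> \<circ> (lift \<circ> c)) (?\<iota> \<circ> y') (?\<iota> t))"
    unfolding Ep_def \<iota>s D's ring_map_Q_val[OF \<iota>] by (simp add: D'_lift D'_t)
  also have "D' (Q_val k S (?\<iota> \<circ> (lift \<circ> c)) (?\<iota> \<circ> y') (?\<iota> t)) = (\<Sum>i\<in>{0..k}. ?\<iota> (dQ i) * D' (?\<iota> (y' i)))"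
    by (subst derivation_Q_val[OF D']) (simp_all add: D'_lift D'_t dQ_def ring_map_Q_deriv[OF \<iota>])
  also have "\<dots> = (\<Sum>i\<in>{0..k}. \<Sum>l\<in>{i..k}. D' (?\<iota> (z' l)) * (?\<iota> (dQ i) * ?\<iota> (monom 1 (l - i))))"
    unfolding D'_y sum_distrib_left by (intro sum.cong) (simp_all add: mult_ac)
  \<comment> \<open>Summation over the triangle \<open>i \<le> l \<le> k\<close> in the other order
    collects the terms of each unknown.\<close>
  also have "\<dots> = (\<Sum>l\<in>{0..k}. \<Sum>i\<in>{0..l}. D' (?\<iota> (z' l)) * (?\<iota> (dQ i) * ?\<iota> (monom 1 (l - i))))"
    unfolding sum.Sigma[OF finite_atLeastAtMost ballI[OF finite_atLeastAtMost]]
    by (rule sum.reindex_bij_witness[of _ "\<lambda>(l, i). (i, l)" "\<lambda>(i, l). (l, i)"]) auto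
  finally have "D' (?\<iota> Ep) = (\<Sum>l\<in>{0..k}. D' (?\<iota> (z' l)) * ?\<iota> (e l))"
    unfolding D'_y e_def \<iota>s
    by (simp add: algebra_simps sum_distrib_left sum_subtractf)
  \<comment> \<open>Differentiating a multiple of \<open>w ^ 2\<close> leaves one factor
    \<open>w\<close>.\<close>
  moreover have "?\<iota> w dvd D' (?\<iota> Ep)"
  proof -
    from w2 obtain s where "Ep = w ^ 2 * s" by (auto elim: dvdE)
    then have "D' (?\<iota> Ep) = ?\<iota> w * (?\<iota> w * D' (?\<iota> s) + 2 * ?\<iota> s * D' (?\<iota> w))"
      by (simp add: \<iota>s D's power2_eq_square algebra_simps)
    then show ?thesis by simp
  qed
  moreover have "{0..k} = insert k {..<k}" by auto
  \<comment> \<open>The derivative of \<open>p\<close> is unknown, but its coefficient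
    \<open>e k\<close> is congruent to dE/dY and hence divisible by \<open>w\<close>; only the
    boundary terms remain.\<close>
  moreover have "?\<iota> w dvd D' (?\<iota> (z' k)) * ?\<iota> (e k)"
    using w_ek by (auto elim!: dvdE simp: \<iota>s)
  ultimately have "?\<iota> w dvd (\<Sum>l<k. D' (?\<iota> (z' l)) * ?\<iota> (e l))"
    by (simp add: dvd_add_right_iff)
  also have "(\<Sum>l<k. D' (?\<iota> (z' l)) * ?\<iota> (e l)) = (\<Sum>l<k. [:D (fps_to_fls (fps_nth \<Phi> l)):] * ?\<iota> (e l))"
    by (intro sum.cong) (simp_all add: z'_def D'_def map_poly_pCons derivation_simps[OF D])
  finally have "?\<iota> w dvd (\<Sum>l<k. [:D (fps_to_fls (fps_nth \<Phi> l)):] * ?\<iota> (e l))" .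
  from independent_mod_distinguished[OF w(1) _ _ d red_e this j] show ?thesis
    using w(2,3) by (simp add: N_def)
qed

subsection \<open>Expansion of rational functions at 0\<close>

text \<open>The choice of a representative follows \<open>ratfun_tu_to_fls\<close>, so that the
  latter is an instance by unfolding. For an injective ring map the choice does not affect the
  value.\<close>

definition fract_lift :: "('a::idom \<Rightarrow> 'b::field) \<Rightarrow> 'a fract \<Rightarrow> 'b" where
  "fract_lift h x = (let r = SOME r. snd r \<noteq> 0 \<and> x = Fraction_Field.Fract (fst r) (snd r)
     in h (fst r) / h (snd r))"

lemma fract_lift_Fract:
  assumes h: "ring_map h" and inj: "\<And>a. h a = 0 \<Longrightarrow> a = 0" and q: "q \<noteq> 0"
  shows "fract_lift h (Fraction_Field.Fract p q) = h p / h q"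
proof -
  define r where "r = (SOME r. snd r \<noteq> 0 \<and> Fraction_Field.Fract p q = Fraction_Field.Fract (fst r) (snd r))"
  have "snd r \<noteq> 0 \<and> Fraction_Field.Fract p q = Fraction_Field.Fract (fst r) (snd r)"
    unfolding r_def by (rule someI[of _ "(p, q)"]) (use q in auto)
  then have r: "snd r \<noteq> 0" "p * snd r = fst r * q" using q by (auto simp: eq_fract)
  have "h p * h (snd r) = h (fst r) * h q"
    using arg_cong[OF r(2), of h] by (simp add: ring_map_simps[OF h])
  moreover have "h (snd r) \<noteq> 0" "h q \<noteq> 0" using inj r(1) q by auto
  ultimately have "h (fst r) / h (snd r) = h p / h q" by (simp add: frac_eq_eq)
  then show ?thesis by (simp add: fract_lift_def r_def Let_def)
qed

lemma ring_map_fract_lift: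
  fixes h :: "'a::idom \<Rightarrow> 'b::field"
  assumes h: "ring_map h" and inj: "\<And>a. h a = 0 \<Longrightarrow> a = 0"
  shows "ring_map (fract_lift h)"
  unfolding ring_map_def
proof (intro conjI allI)
  note lift = fract_lift_Fract[OF h inj]
  fix x y :: "'a fract"
  obtain a b where x: "x = Fraction_Field.Fract a b" "b \<noteq> 0" by (cases x)
  obtain c d where y: "y = Fraction_Field.Fract c d" "d \<noteq> 0" by (cases y)
  have nz: "h b \<noteq> 0" "h d \<noteq> 0" using inj x y by auto
  show "fract_lift h (x + y) = fract_lift h x + fract_lift h y"
    using x y nz by (simp add: lift ring_map_simps[OF h] add_frac_eq)
  show "fract_lift h (x * y) = fract_lift h x * fract_lift h y"
    using x y nz by (simp add: lift ring_map_simps[OF h])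
  show "fract_lift h 1 = 1"
    by (simp add: One_fract_def lift ring_map_simps[OF h])
qed

section \<open>Embeddings of K, K[u] and K[u,t]\<close>

lemma ring_map_Fract: "ring_map (\<lambda>p. Fraction_Field.Fract p 1)"
  by (auto simp: ring_map_def One_fract_def)

lemma Fract_1_eq_0_iff [simp]: "Fraction_Field.Fract p 1 = 0 \<longleftrightarrow> p = 0"
  by (simp add: Zero_fract_def eq_fract)

lemma ring_map_const_ratfun: "ring_map const_ratfun"
  by (auto simp: ring_map_def const_ratfun_def One_fract_def one_pCons mult.commute)

lemma const_ratfun_eq_0_iff [simp]: "const_ratfun a = 0 \<longleftrightarrow> a = 0"
  by (simp add: const_ratfun_def)

lemma const_ratfun_divide: "b \<noteq> 0 \<Longrightarrow> const_ratfun (a / b) = const_ratfun a / const_ratfun b"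
  by (simp add: const_ratfun_def eq_fract)

lemma var_u_nonzero: "var_u \<noteq> 0"
  by (simp add: var_u_def)

lemma bivar_to_fls_altdef:
  "bivar_to_fls = fps_to_fls \<circ> (fps_of_poly \<circ> map_poly (\<lambda>p. Fraction_Field.Fract p 1))"
  by (simp add: fun_eq_iff bivar_to_fls_def)

lemma ring_map_bivar_to_fls: "ring_map bivar_to_fls"
  unfolding bivar_to_fls_altdef
  by (intro ring_map_comp ring_map_map_poly ring_map_fps_to_fls ring_map_fps_of_poly ring_map_Fract)

lemma bivar_to_fls_eq_0:
  assumes "bivar_to_fls p = 0"
  shows "p = 0"
proof -
  have "fps_of_poly (map_poly (\<lambda>p. Fraction_Field.Fract p 1) p) = fps_of_poly 0"
    using assms by (simp add: bivar_to_fls_def)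
  then have "map_poly (\<lambda>p. Fraction_Field.Fract p 1) p = 0" by (simp only: fps_of_poly_eq_iff)
  then show ?thesis by (subst (asm) map_poly_eq_0_iff) auto
qed

lemma ratfun_tu_to_fls_altdef: "ratfun_tu_to_fls = fract_lift bivar_to_fls"
  by (simp add: fun_eq_iff ratfun_tu_to_fls_def fract_lift_def)

lemma ratfun_tu_to_fls_of_poly: "ratfun_tu_to_fls (Fraction_Field.Fract p 1) = bivar_to_fls p"
  unfolding ratfun_tu_to_fls_altdef
  by (simp add: fract_lift_Fract[OF ring_map_bivar_to_fls bivar_to_fls_eq_0]
      ring_map_simps[OF ring_map_bivar_to_fls])

text \<open>The expansion of a rational function at 0 is written in a new formal variable; its
  coefficients are the elements of K, embedded as constants into K(u).\<close>

definition expand_poly :: "'a::field poly \<Rightarrow> 'a poly fract fps" where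
  "expand_poly p = fps_of_poly (map_poly const_ratfun p)"

definition expand :: "'a::field poly fract \<Rightarrow> 'a poly fract fls" where
  "expand = fract_lift (fps_to_fls \<circ> expand_poly)"

lemma ring_map_expand_poly: "ring_map (expand_poly :: 'a::field poly \<Rightarrow> _)"
proof -
  have "expand_poly = (fps_of_poly \<circ> map_poly const_ratfun :: 'a poly \<Rightarrow> _)"
    by (simp add: fun_eq_iff expand_poly_def)
  then show ?thesis
    using ring_map_comp[OF ring_map_fps_of_poly ring_map_map_poly[OF ring_map_const_ratfun]] by metis
qed

lemma expand_poly_nth: "fps_nth (expand_poly p) n = const_ratfun (coeff p n)"
  by (simp add: expand_poly_def coeff_map_poly)

lemma expand_poly_eq_0: "expand_poly p = 0 \<Longrightarrow> p = 0"
  by (simp add: fps_eq_iff expand_poly_nth poly_eq_iff)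

lemma ring_map_fps_to_fls_expand_poly: "ring_map (fps_to_fls \<circ> expand_poly)"
  by (intro ring_map_comp ring_map_fps_to_fls ring_map_expand_poly)

lemma ring_map_expand: "ring_map expand"
  unfolding expand_def
  by (rule ring_map_fract_lift[OF ring_map_fps_to_fls_expand_poly]) (simp add: expand_poly_eq_0)

lemma expand_Fract:
  "q \<noteq> 0 \<Longrightarrow> expand (Fraction_Field.Fract p q) = fps_to_fls (expand_poly p) / fps_to_fls (expand_poly q)"
  unfolding expand_def
  by (subst fract_lift_Fract[OF ring_map_fps_to_fls_expand_poly]) (auto simp: expand_poly_eq_0)

lemma expand_of_poly: "expand (Fraction_Field.Fract p 1) = fps_to_fls (expand_poly p)"
  by (simp add: expand_Fract ring_map_simps[OF ring_map_expand_poly])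

lemma expand_const_ratfun: "expand (const_ratfun a) = fls_const (const_ratfun a)"
proof -
  have "expand_poly [:a:] = fps_const (const_ratfun a)"
    by (simp add: expand_poly_def map_poly_pCons fps_of_poly_const)
  then show ?thesis by (subst const_ratfun_def) (simp add: expand_of_poly)
qed

lemma expand_var_u: "expand var_u = fls_X"
proof -
  have "expand_poly [:0, 1:] = (fps_X :: 'a::field poly fract fps)"
    by (simp add: expand_poly_def map_poly_pCons ring_map_simps[OF ring_map_const_ratfun])
  then show ?thesis by (simp add: var_u_def expand_of_poly)
qed

text \<open>Cross-multiplying two representations and evaluating at 0 shows that the description by
  \<open>THE\<close> is unambiguous.\<close>

lemma eval_at_0_Fract:
  assumes "poly q 0 \<noteq> 0"
  shows "eval_at_0 (Fraction_Field.Fract p q) = poly p 0 / poly q 0"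
  unfolding eval_at_0_def
proof (rule the_equality)
  show "\<exists>p' q'. poly q' 0 \<noteq> 0 \<and> Fraction_Field.Fract p q = Fraction_Field.Fract p' q'
      \<and> poly p 0 / poly q 0 = poly p' 0 / poly q' 0" using assms by blast
next
  fix v assume "\<exists>p' q'. poly q' 0 \<noteq> 0 \<and> Fraction_Field.Fract p q = Fraction_Field.Fract p' q'
      \<and> v = poly p' 0 / poly q' 0"
  then obtain p' q' where *: "poly q' 0 \<noteq> 0" "Fraction_Field.Fract p q = Fraction_Field.Fract p' q'"
    "v = poly p' 0 / poly q' 0" by blast
  then have "p * q' = p' * q" using assms by (subst (asm) eq_fract) auto
  from arg_cong[OF this, of "\<lambda>r. poly r 0"] have "poly p 0 * poly q' 0 = poly p' 0 * poly q 0" by simp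
  then show "v = poly p 0 / poly q 0" using *(1) assms by (simp add: *(3) frac_eq_eq)
qed

text \<open>A denominator that does not vanish at 0 is invertible as a power series.\<close>

lemma expand_no_pole:
  assumes "no_pole_at_0 x"
  obtains s where "expand x = fps_to_fls s" "fps_nth s 0 = const_ratfun (eval_at_0 x)"
proof -
  from assms obtain p q where q: "poly q 0 \<noteq> 0" and x: "x = Fraction_Field.Fract p q"
    by (auto simp: no_pole_at_0_def)
  have q0: "q \<noteq> 0" using q by auto
  have Q0: "fps_nth (expand_poly q) 0 \<noteq> 0" using q by (simp add: expand_poly_nth poly_0_coeff_0)
  define s where "s = expand_poly p * inverse (expand_poly q)"
  have "s * expand_poly q = expand_poly p"
    using inverse_mult_eq_1[OF Q0] by (simp add: s_def mult.assoc)
  then have "fps_to_fls s * fps_to_fls (expand_poly q) = fps_to_fls (expand_poly p)"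
    by (simp flip: fls_times_fps_to_fls)
  moreover have "expand_poly q \<noteq> 0" using q0 expand_poly_eq_0 by blast
  ultimately have "expand x = fps_to_fls s"
    by (simp add: x expand_Fract[OF q0] divide_eq_eq)
  moreover have "fps_nth s 0 = const_ratfun (eval_at_0 x)"
    using q by (simp add: s_def x eval_at_0_Fract const_ratfun_divide expand_poly_nth poly_0_coeff_0 divide_inverse[of "const_ratfun _"])
  ultimately show thesis by (rule that)
qed

text \<open>The numerator of the difference vanishes at 0, so its factor u cancels.\<close>

lemma no_pole_at_0_shift:
  assumes "no_pole_at_0 x"
  shows "no_pole_at_0 ((x - const_ratfun (eval_at_0 x)) / var_u)"
proof -
  from assms obtain p q where q: "poly q 0 \<noteq> 0" and x: "x = Fraction_Field.Fract p q"
    by (auto simp: no_pole_at_0_def)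
  define a where "a = eval_at_0 x"
  have "poly (p - [:a:] * q) 0 = 0" using q by (simp add: a_def x eval_at_0_Fract)
  then obtain r where r: "p - [:a:] * q = [:0, 1:] * r"
    by (metis dvdE minus_zero poly_eq_0_iff_dvd)
  have "q \<noteq> 0" using q by auto
  then have "x - const_ratfun a = Fraction_Field.Fract (p - [:a:] * q) q"
    by (simp add: x const_ratfun_def)
  also note r
  finally have "x - const_ratfun a = Fraction_Field.Fract ([:0, 1:] * r) q" .
  then have "(x - const_ratfun a) / var_u = Fraction_Field.Fract ([:0, 1:] * r) ([:0, 1:] * q)"
    by (simp add: var_u_def mult.commute)
  also have "\<dots> = Fraction_Field.Fract r q" by (rule mult_fract_cancel) simp
  finally show ?thesis using q unfolding no_pole_at_0_def a_def by blast
qed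

text \<open>Removing the value at 0 and dividing by u drops the first term of the expansion. The
  value at 0 of the \<open>i\<close>-th iterate is therefore the \<open>i\<close>-th coefficient of
  the original expansion.\<close>

lemma Delta_iterate:
  assumes F: "\<And>n. no_pole_at_0 (fps_nth F n)" and f: "\<And>n. expand (fps_nth F n) = fps_to_fls (f n)"
  shows "no_pole_at_0 (fps_nth ((Delta ^^ i) F) n)"
    and "expand (fps_nth ((Delta ^^ i) F) n) = fps_to_fls (fps_shift i (f n))"
    and "const_ratfun (eval_at_0 (fps_nth ((Delta ^^ i) F) n)) = fps_nth (f n) i"
proof -
  have *: "no_pole_at_0 (fps_nth ((Delta ^^ i) F) n)
      \<and> expand (fps_nth ((Delta ^^ i) F) n) = fps_to_fls (fps_shift i (f n))" for i
  proof (induction i)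
    case 0
    then show ?case using F f by simp
  next
    case (Suc i)
    let ?x = "fps_nth ((Delta ^^ i) F) n"
    have step: "fps_nth ((Delta ^^ Suc i) F) n = (?x - const_ratfun (eval_at_0 ?x)) / var_u"
      by (simp add: Delta_def)
    obtain s where s: "expand ?x = fps_to_fls s" "fps_nth s 0 = const_ratfun (eval_at_0 ?x)"
      using expand_no_pole Suc by blast
    then have "s = fps_shift i (f n)" using Suc by simp
    moreover have "fps_X * fps_shift 1 s = s - fps_const (fps_nth s 0)"
      by (auto simp: fps_eq_iff fps_X_mult_nth)
    ultimately have "fls_X * fps_to_fls (fps_shift (Suc i) (f n)) = expand ?x - fls_const (fps_nth s 0)"
      using s(1) by (metis fls_times_fps_to_fls fps_X_to_fls fps_const_to_fls fps_shift_fps_shift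
          fps_to_fls_minus plus_1_eq_Suc)
    moreover have "expand (fps_nth ((Delta ^^ Suc i) F) n) * fls_X = expand ?x - fls_const (fps_nth s 0)"
    proof -
      have "fps_nth ((Delta ^^ Suc i) F) n * var_u = ?x - const_ratfun (eval_at_0 ?x)"
        unfolding step by (simp add: var_u_nonzero)
      from arg_cong[OF this, of expand] show ?thesis
        by (simp add: ring_map_simps[OF ring_map_expand] expand_var_u expand_const_ratfun s(2))
    qed
    ultimately have "fls_X * expand (fps_nth ((Delta ^^ Suc i) F) n) = fls_X * fps_to_fls (fps_shift (Suc i) (f n))"
      by (simp add: mult.commute)
    then have "expand (fps_nth ((Delta ^^ Suc i) F) n) = fps_to_fls (fps_shift (Suc i) (f n))" by simp
    moreover have "no_pole_at_0 (fps_nth ((Delta ^^ Suc i) F) n)"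
      unfolding step using Suc by (intro no_pole_at_0_shift) auto
    ultimately show ?case by blast
  qed
  then show "no_pole_at_0 (fps_nth ((Delta ^^ i) F) n)"
    and ex: "expand (fps_nth ((Delta ^^ i) F) n) = fps_to_fls (fps_shift i (f n))" by blast+
  obtain s where "expand (fps_nth ((Delta ^^ i) F) n) = fps_to_fls s"
    "fps_nth s 0 = const_ratfun (eval_at_0 (fps_nth ((Delta ^^ i) F) n))"
    using expand_no_pole * by blast
  with ex show "const_ratfun (eval_at_0 (fps_nth ((Delta ^^ i) F) n)) = fps_nth (f n) i" by simp
qed

section \<open>Clearing denominators and expanding the functional equation\<close>

lemma common_denominator:
  fixes A :: "'a::idom fract set"
  assumes "finite A"
  shows "\<exists>d. d \<noteq> 0 \<and> (\<forall>x\<in>A. \<exists>p. Fraction_Field.Fract d 1 * x = Fraction_Field.Fract p 1)"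
  using assms
proof (induction A rule: finite_induct)
  case (insert x A)
  then obtain d where d: "d \<noteq> 0" "\<And>y. y \<in> A \<Longrightarrow> \<exists>p. Fraction_Field.Fract d 1 * y = Fraction_Field.Fract p 1"
    by blast
  obtain a b where x: "x = Fraction_Field.Fract a b" "b \<noteq> 0" by (cases x)
  have "Fraction_Field.Fract (b * d) 1 * x = Fraction_Field.Fract (d * a) 1"
    using x by (simp add: eq_fract)
  moreover have "\<exists>p. Fraction_Field.Fract (b * d) 1 * y = Fraction_Field.Fract p 1" if "y \<in> A" for y
  proof -
    from d(2)[OF that] obtain p where p: "Fraction_Field.Fract d 1 * y = Fraction_Field.Fract p 1" by blast
    have "Fraction_Field.Fract (b * d) 1 * y = Fraction_Field.Fract b 1 * (Fraction_Field.Fract d 1 * y)"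
      by (simp flip: mult.assoc)
    then show ?thesis using p by auto
  qed
  ultimately show ?case using d(1) x(2) by (intro exI[of _ "b * d"]) auto
qed (auto intro: exI[of _ 1])

lemma swap_fps_fps_const: "swap_fps (fps_const a) = map_fps fps_const a"
  by (auto simp: fps_eq_iff)

lemma swap_fps_fps_X: "swap_fps (fps_X :: 'a::comm_ring_1 fps fps) = fps_const fps_X"
  by (auto simp: fps_eq_iff fps_X_def)

text \<open>Denominators are cleared, \<open>expand\<close> is applied to each coefficient of t, the
  embedding into Laurent series in X is cancelled, and the variables are exchanged.\<close>

lemma expanded_equation:
  fixes F :: "'a::field poly fract fps"
  assumes F: "\<And>n. no_pole_at_0 (fps_nth F n)" and f: "\<And>n. expand (fps_nth F n) = fps_to_fls (f n)"
    and S: "finite S" and eq: "F = fps_const F0 + fps_X * eval_Q k S c F"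
  obtains d f0 c' where "d \<noteq> 0"
    "fps_of_poly (map_poly fps_const d) * swap_fps (Abs_fps f) = fps_of_poly (map_poly fps_const f0)
      + fps_const fps_X * Q_val k S (\<lambda>m. fps_of_poly (map_poly fps_const (c' m)))
          (\<lambda>i. fps_shift i (swap_fps (Abs_fps f))) (fps_const fps_X)"
proof -
  obtain d where d: "d \<noteq> 0"
    and poly: "\<forall>x\<in>insert F0 (c ` S). \<exists>p. Fraction_Field.Fract d 1 * x = Fraction_Field.Fract p 1"
    using common_denominator[of "insert F0 (c ` S)"] S by blast
  from poly obtain f0 where f0: "Fraction_Field.Fract d 1 * F0 = Fraction_Field.Fract f0 1" by blast
  from poly have "\<forall>m\<in>S. \<exists>p. Fraction_Field.Fract d 1 * c m = Fraction_Field.Fract p 1" by blast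
  from bchoice[OF this] obtain c' where c':
    "\<And>m. m \<in> S \<Longrightarrow> Fraction_Field.Fract d 1 * c m = Fraction_Field.Fract (c' m) 1" by blast
  define C where "C p = fps_const (Fraction_Field.Fract p 1 :: 'a poly fract)" for p
  have "C d * F = C f0 + fps_X * Q_val k S (C \<circ> c') (\<lambda>i. (Delta ^^ i) F) fps_X"
  proof -
    have "C d * F = C d * (fps_const F0 + fps_X * Q_val k S (\<lambda>m. fps_const (c m)) (\<lambda>i. (Delta ^^ i) F) fps_X)"
      using eq by (simp add: eval_Q_def Q_val_def)
    also have "\<dots> = C d * fps_const F0 + fps_X * (C d * Q_val k S (\<lambda>m. fps_const (c m)) (\<lambda>i. (Delta ^^ i) F) fps_X)"
      by (simp only: distrib_left mult.left_commute)
    also have "C d * fps_const F0 = C f0" by (simp add: C_def f0)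
    also have "C d * Q_val k S (\<lambda>m. fps_const (c m)) (\<lambda>i. (Delta ^^ i) F) fps_X
        = Q_val k S (C \<circ> c') (\<lambda>i. (Delta ^^ i) F) fps_X"
      unfolding Q_val_scale by (intro Q_val_cong) (simp_all add: C_def c')
    finally show ?thesis .
  qed
  from arg_cong[OF this, of "map_fps expand"]
  have 1: "map_fps expand (C d) * map_fps expand F = map_fps expand (C f0) + map_fps expand fps_X
      * Q_val k S (\<lambda>m. map_fps expand (C (c' m))) (\<lambda>i. map_fps expand ((Delta ^^ i) F)) (map_fps expand fps_X)"
    by (simp add: ring_map_simps[OF ring_map_map_fps[OF ring_map_expand]]
        ring_map_Q_val[OF ring_map_map_fps[OF ring_map_expand]] o_def)
  \<comment> \<open>All terms of the expanded equation lie in the image of the injective ring map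
    \<open>J\<close>, so the equation already holds between power series in X.\<close>
  define J where "J = (map_fps fps_to_fls :: 'a poly fract fps fps \<Rightarrow> _)"
  have J: "ring_map J" unfolding J_def by (intro ring_map_map_fps ring_map_fps_to_fls)
  have J_inj: "a = b" if "J a = J b" for a b
  proof (rule fps_ext)
    fix n
    from arg_cong[OF that, of "\<lambda>f. fps_nth f n"] show "fps_nth a n = fps_nth b n" by (simp add: J_def)
  qed
  define G where "G i = Abs_fps (\<lambda>n. fps_shift i (f n))" for i
  have J_C: "map_fps expand (C p) = J (fps_const (expand_poly p))" for p
    by (auto simp: fps_eq_iff C_def J_def expand_of_poly ring_map_simps[OF ring_map_expand])
  have J_X: "map_fps expand fps_X = J fps_X"
    by (auto simp: fps_eq_iff J_def ring_map_simps[OF ring_map_expand] fps_X_nth)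
  have J_G: "map_fps expand ((Delta ^^ i) F) = J (G i)" for i
    by (simp add: fps_eq_iff J_def G_def Delta_iterate(2)[OF F f])
  have J_F: "map_fps expand F = J (G 0)" using J_G[of 0] by simp
  have "J (fps_const (expand_poly d) * G 0) = J (fps_const (expand_poly f0)
      + fps_X * Q_val k S (\<lambda>m. fps_const (expand_poly (c' m))) G fps_X)"
    using 1 J_F unfolding J_C J_X J_G
    by (simp add: ring_map_simps[OF J] ring_map_Q_val[OF J] o_def)
  then have "fps_const (expand_poly d) * G 0 = fps_const (expand_poly f0)
      + fps_X * Q_val k S (\<lambda>m. fps_const (expand_poly (c' m))) G fps_X"
    by (rule J_inj)
  from arg_cong[OF this, of swap_fps]
  have 2: "swap_fps (fps_const (expand_poly d)) * swap_fps (G 0) = swap_fps (fps_const (expand_poly f0))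
      + swap_fps fps_X * Q_val k S (\<lambda>m. swap_fps (fps_const (expand_poly (c' m)))) (\<lambda>i. swap_fps (G i)) (swap_fps fps_X)"
    by (simp add: ring_map_simps[OF ring_map_swap_fps] ring_map_Q_val[OF ring_map_swap_fps] o_def)
  have swap_G: "swap_fps (G i) = fps_shift i (swap_fps (Abs_fps f))" for i
    by (simp add: fps_eq_iff G_def)
  have swap_const: "swap_fps (fps_const (expand_poly p)) = fps_of_poly (map_poly fps_const (map_poly const_ratfun p))" for p
    by (simp add: swap_fps_fps_const expand_poly_def fps_of_poly_map_poly)
  have "map_poly const_ratfun d \<noteq> 0" using d by (subst map_poly_eq_0_iff) auto
  then show thesis
    using that[of "map_poly const_ratfun d" "map_poly const_ratfun f0" "\<lambda>m. map_poly const_ratfun (c' m)"] 2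
    unfolding swap_G swap_const swap_fps_fps_X by simp
qed

section \<open>Algebraicity of F over K(t,u)\<close>

theorem theorem9p1:
  fixes F :: "'a::field_char_0 poly fract fps"
    and F0 :: "'a poly fract"
    and k :: nat
    and S :: "((nat \<Rightarrow> nat) \<times> nat) set"
    and c :: "(nat \<Rightarrow> nat) \<times> nat \<Rightarrow> 'a poly fract"
  assumes "\<forall>n. no_pole_at_0 (fps_nth F n)"
    and "finite S"
    and "F = fps_const F0 + fps_X * eval_Q k S c F"
  shows "algebraic_over_Ktu F"
proof -
  from assms(1) have no_pole: "no_pole_at_0 (fps_nth F n)" for n by blast
  have "\<exists>s. expand (fps_nth F n) = fps_to_fls s" for n
    using expand_no_pole[OF no_pole[of n]] by blast
  then obtain f where f: "\<And>n. expand (fps_nth F n) = fps_to_fls (f n)" by metis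
  define \<Phi> where "\<Phi> = swap_fps (Abs_fps f)"
  obtain d f0 c' where d: "d \<noteq> 0" and \<Phi>: "fps_of_poly (map_poly fps_const d) * \<Phi>
      = fps_of_poly (map_poly fps_const f0)
      + fps_const fps_X * Q_val k S (\<lambda>m. fps_of_poly (map_poly fps_const (c' m)))
          (\<lambda>i. fps_shift i \<Phi>) (fps_const fps_X)"
    using expanded_equation[OF no_pole f assms(2,3)] unfolding \<Phi>_def by blast
  let ?x = "fps_to_fls F"
  have killed: "D ?x = 0" if D: "derivation D" and D0: "\<And>p. D (bivar_to_fls p) = 0" for D
  proof -
    note Ds = derivation_simps[OF D]
    \<comment> \<open>An element of K(u) times its denominator lies in K[u], where \<open>D\<close>
      vanishes.\<close>
    have D_const: "D (fls_const a) = 0" for a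
    proof -
      obtain p q where a: "a = Fraction_Field.Fract p q" "q \<noteq> 0" by (cases a)
      have C: "bivar_to_fls [:r:] = fls_const (Fraction_Field.Fract r 1)" for r
        by (simp add: bivar_to_fls_def map_poly_pCons fps_of_poly_const)
      have "a * Fraction_Field.Fract q 1 = Fraction_Field.Fract p 1" using a by (simp add: eq_fract)
      then have "fls_const a * bivar_to_fls [:q:] = bivar_to_fls [:p:]" by (simp add: C)
      from arg_cong[OF this, of D] have "bivar_to_fls [:q:] * D (fls_const a) = 0" by (simp add: Ds D0)
      moreover have "bivar_to_fls [:q:] \<noteq> 0" using a by (simp add: C)
      ultimately show ?thesis by simp
    qed
    have D_X: "D fls_X = 0"
      using D0[of "[:0, 1:]"]
      by (simp add: bivar_to_fls_def map_poly_pCons ring_map_simps[OF ring_map_Fract])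
    define \<delta> where "\<delta> i = D (fps_to_fls ((Delta ^^ i) F))" for i
    define u where "u = inverse (var_u :: 'a poly fract)"
    \<comment> \<open>Since u Delta^(i+1) F = Delta^i F - G_i and \<open>D\<close> kills both u and
      G_i for \<open>i < k\<close>, each step only divides by u.\<close>
    have \<delta>: "\<delta> i = fls_const (u ^ i) * D ?x" if "i \<le> k" for i
      using that
    proof (induction i)
      case (Suc i)
      have "fps_const var_u * (Delta ^^ Suc i) F = (Delta ^^ i) F - fps_nth \<Phi> i"
        using Delta_iterate(3)[OF no_pole f, of i] by (simp add: fps_eq_iff Delta_def \<Phi>_def var_u_nonzero)
      from arg_cong[OF this, of "D \<circ> fps_to_fls"]
      have "fls_const var_u * \<delta> (Suc i) = \<delta> i"
        using derivation_kills_boundary_coeffs[OF d \<Phi> D D_const D_X, of i] Suc.prems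
        by (simp add: \<delta>_def Ds fls_times_fps_to_fls D_const del: funpow.simps)
      then have "fls_const u * (fls_const var_u * \<delta> (Suc i)) = fls_const u * \<delta> i" by simp
      moreover have "fls_const u * (fls_const var_u * \<delta> (Suc i)) = \<delta> (Suc i)"
        by (simp add: u_def var_u_nonzero flip: mult.assoc)
      ultimately show ?case using Suc by (simp flip: mult.assoc)
    qed (simp add: \<delta>_def)
    define q where "q i = Q_deriv k S (\<lambda>m. fps_const (c m)) (\<lambda>i. (Delta ^^ i) F) fps_X i" for i
    have "?x = fls_const F0 + fls_X * Q_val k S (\<lambda>m. fls_const (c m)) (\<lambda>i. fps_to_fls ((Delta ^^ i) F)) fls_X"
    proof -
      have "F = fps_const F0 + fps_X * Q_val k S (\<lambda>m. fps_const (c m)) (\<lambda>i. (Delta ^^ i) F) fps_X"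
        using assms(3) by (simp add: eval_Q_def Q_val_def)
      from arg_cong[OF this, of fps_to_fls] show ?thesis
        by (simp add: ring_map_simps[OF ring_map_fps_to_fls] ring_map_Q_val[OF ring_map_fps_to_fls] o_def)
    qed
    from arg_cong[OF this, of D]
    have "D ?x = fls_X * (\<Sum>i\<in>{0..k}. fps_to_fls (q i) * \<delta> i)"
      by (simp add: Ds D_const D_X derivation_Q_val[OF D] \<delta>_def q_def ring_map_Q_deriv[OF ring_map_fps_to_fls] o_def)
    also have "(\<Sum>i\<in>{0..k}. fps_to_fls (q i) * \<delta> i) = fps_to_fls (\<Sum>i\<in>{0..k}. q i * fps_const (u ^ i)) * D ?x"
      unfolding ring_map_simps(9)[OF ring_map_fps_to_fls] sum_distrib_right
      by (intro sum.cong) (simp_all add: \<delta> fls_times_fps_to_fls)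
    \<comment> \<open>All derivatives are now multiples of \<open>D ?x\<close>; the remaining factor
      has constant term 1 in t and so is nonzero.\<close>
    finally have "D ?x * fps_to_fls (1 - fps_X * (\<Sum>i\<in>{0..k}. q i * fps_const (u ^ i))) = 0"
      by (simp add: fls_times_fps_to_fls algebra_simps)
    moreover have "fps_nth (1 - fps_X * (\<Sum>i\<in>{0..k}. q i * fps_const (u ^ i))) 0 = 1" by simp
    then have "1 - fps_X * (\<Sum>i\<in>{0..k}. q i * fps_const (u ^ i)) \<noteq> 0"
      by (metis fps_zero_nth zero_neq_one)
    ultimately show ?thesis by (simp only: mult_eq_0_iff fps_to_fls_eq_0_iff simp_thms)
  qed
  let ?B = "range (bivar_to_fls :: 'a poly poly \<Rightarrow> _)"
  note Bs = ring_map_simps[where h = "bivar_to_fls :: 'a poly poly \<Rightarrow> _", OF ring_map_bivar_to_fls]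
  have "\<exists>p. (\<forall>i. coeff p i \<in> ?B) \<and> poly p ?x = 0 \<and> p \<noteq> 0"
  proof (rule ccontr)
    assume *: "\<not> ?thesis"
    \<comment> \<open>If \<open>F\<close> were transcendental over K[u,t], some derivation vanishing
      there would send it to 1, contradicting \<open>killed\<close>.\<close>
    have "\<exists>D. derivation D \<and> (\<forall>y\<in>?B. D y = 0) \<and> D ?x = 1"
    proof (rule transcendental_imp_derivation)
      show "(of_nat n :: 'a poly fract fls) \<noteq> 0" if "n > 0" for n
        using that Bs(8)[of n] bivar_to_fls_eq_0[of "of_nat n :: 'a poly poly"] by (auto simp: of_nat_poly)
      show "1 \<in> ?B" using Bs(3) by (metis rangeI)
      show "x - y \<in> ?B" "x * y \<in> ?B" if "x \<in> ?B" "y \<in> ?B" for x y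
        using that by (auto simp flip: Bs)
    qed (use * in blast)
    with killed show False by force
  qed
  then obtain p where p: "\<And>i. coeff p i \<in> ?B" "poly p ?x = 0" "p \<noteq> 0" by blast
  \<comment> \<open>A preimage in K[u,t] of each coefficient, turned into an element of K(t,u). That
    \<open>g\<close> sends 0 to 0 is needed for \<open>map_poly\<close> to act
    coefficientwise.\<close>
  define g where "g y = Fraction_Field.Fract (inv bivar_to_fls y) (1 :: 'a poly poly)" for y
  have g: "ratfun_tu_to_fls (g y) = y" if "y \<in> ?B" for y
    using that by (simp add: g_def ratfun_tu_to_fls_of_poly f_inv_into_f)
  have "bivar_to_fls (inv bivar_to_fls 0) = (0 :: 'a poly fract fls)"
    using Bs(4) by (metis f_inv_into_f rangeI)
  then have g0: "g 0 = 0" using bivar_to_fls_eq_0 by (simp add: g_def)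
  have r0: "ratfun_tu_to_fls (0 :: 'a poly poly fract) = 0"
    using ratfun_tu_to_fls_of_poly[of "0 :: 'a poly poly"] Bs(4) by (simp add: Zero_fract_def)
  have "map_poly ratfun_tu_to_fls (map_poly g p) = p"
    by (simp add: poly_eq_iff coeff_map_poly g0 r0 g p(1))
  with p(2,3) show ?thesis
    unfolding algebraic_over_Ktu_def by (intro exI[of _ "map_poly g p"]) auto
qed

end
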